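(* Let $f\in C^2(\mathbb{R})$ and $g\in C^1(\mathbb{R})$ satisfy $f''(u)>0$ and $g'(u)>0$ for every $u\in\mathbb{R}$. For every fixed $\epsilon>0$ and every $u_+\in\mathbb{R}$ there exists $\delta_0>0$ such that the following holds. Let $u_-\in\mathbb{R}$ with $0<|u_+-u_-|<\delta_0$, let $c=\dfrac{f(u_+)-f(u_-)}{u_+-u_-}$ (Rankine--Hugoniot relation), and assume the Lax condition $f'(u_+)<c<f'(u_-)$. Then the parabolic-elliptic system $$ \partial_t u+\partial_x f(u)-\epsilon\,\partial_{xx}u=\partial_x v,\qquad v-\partial_{xx}v=\partial_x g(u) $$ supports a propagating front with asymptotic states $u_\pm$ and speed $c$.
   Context: Propagating front: given $u_\pm\in\mathbb{R}$, a propagating front for the system is a triple $(u,v;c)$ where $c\in\mathbb{R}$ is a constant (the speed) and $(u,v)=(u,v)(x-ct)$ is a travelling wave solution of the system (the profile) satisfying the asymptotic conditions $(u,v)(\pm\infty)=(u_\pm,0)$. *)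

theory Defs imports "HOL-Analysis.Analysis"
begin

definition C2_real :: "(real \<Rightarrow> real) \<Rightarrow> bool" where
  "C2_real f \<longleftrightarrow> f C1_differentiable_on UNIV \<and> deriv f C1_differentiable_on UNIV"

text \<open>Functions of time and space are written \<open>w t x\<close>.\<close>

definition dt :: "(real \<Rightarrow> real \<Rightarrow> real) \<Rightarrow> real \<Rightarrow> real \<Rightarrow> real" where
  "dt w t x = deriv (\<lambda>s. w s x) t"

definition dx :: "(real \<Rightarrow> real \<Rightarrow> real) \<Rightarrow> real \<Rightarrow> real \<Rightarrow> real" where
  "dx w t x = deriv (\<lambda>y. w t y) x"

definition jointly_continuous :: "(real \<Rightarrow> real \<Rightarrow> real) \<Rightarrow> bool" where
  "jointly_continuous w \<longleftrightarrow> continuous_on UNIV (\<lambda>(t, x). w t x)"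

definition C1_in_time :: "(real \<Rightarrow> real \<Rightarrow> real) \<Rightarrow> bool" where
  "C1_in_time w \<longleftrightarrow>
     (\<forall>t x. (\<lambda>s. w s x) differentiable (at t)) \<and> jointly_continuous (dt w)"

definition C2_in_space :: "(real \<Rightarrow> real \<Rightarrow> real) \<Rightarrow> bool" where
  "C2_in_space w \<longleftrightarrow>
     (\<forall>t x. (\<lambda>y. w t y) differentiable (at x)) \<and>
     (\<forall>t x. (\<lambda>y. dx w t y) differentiable (at x)) \<and>
     jointly_continuous w \<and> jointly_continuous (dx w) \<and> jointly_continuous (dx (dx w))"

text \<open>Solutions are classical: every derivative of \<open>u\<close> and \<open>v\<close> occurring in the system
  exists everywhere and is continuous. No time derivative of \<open>v\<close> occurs, so none is required.\<close>

definition classical_solution ::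
  "real \<Rightarrow> (real \<Rightarrow> real) \<Rightarrow> (real \<Rightarrow> real) \<Rightarrow>
   (real \<Rightarrow> real \<Rightarrow> real) \<Rightarrow> (real \<Rightarrow> real \<Rightarrow> real) \<Rightarrow> bool" where
  "classical_solution \<epsilon> f g u v \<longleftrightarrow>
     C1_in_time u \<and> C2_in_space u \<and> C2_in_space v \<and>
     (\<forall>t x. dt u t x + dx (\<lambda>s y. f (u s y)) t x - \<epsilon> * dx (dx u) t x = dx v t x) \<and>
     (\<forall>t x. v t x - dx (dx v) t x = dx (\<lambda>s y. g (u s y)) t x)"

definition propagating_front ::
  "real \<Rightarrow> (real \<Rightarrow> real) \<Rightarrow> (real \<Rightarrow> real) \<Rightarrow> real \<Rightarrow> real \<Rightarrow>
   (real \<Rightarrow> real) \<Rightarrow> (real \<Rightarrow> real) \<Rightarrow> real \<Rightarrow> bool" where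
  "propagating_front \<epsilon> f g u_minus u_plus U V c \<longleftrightarrow>
     classical_solution \<epsilon> f g (\<lambda>t x. U (x - c * t)) (\<lambda>t x. V (x - c * t)) \<and>
     (U \<longlongrightarrow> u_minus) at_bot \<and> (U \<longlongrightarrow> u_plus) at_top \<and>
     (V \<longlongrightarrow> 0) at_bot \<and> (V \<longlongrightarrow> 0) at_top"

end

theory Submission imports Defs "HOL-Probability.Distributions" "HOL-Probability.Helly_Selection"
begin

text \<open>
Write \<open>K\<close> for convolution with \<open>exp (- \<bar>x\<bar>) / 2\<close>, the inverse of \<open>1 - d^2/dx^2\<close>, and \<open>K'\<close> for
convolution with the derivative of that kernel. The elliptic equation of a front \<open>U\<close> gives \<open>V = K' g(U)\<close>,
and the parabolic one integrates once. The Lax condition makes \<open>U\<close> decrease, so let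
\<open>w x = U (- x)\<close>, which has to increase from \<open>a = u_plus\<close> to \<open>b = u_minus\<close>, and let \<open>H\<close> be
the chord of \<open>f\<close> over \<open>[a, b]\<close> minus \<open>f\<close>. By convexity \<open>H\<close> vanishes at \<open>a\<close> and \<open>b\<close> only and is
positive in between, and the profile equation is
\<open>\<epsilon> w' + K' g(w) = H(w)\<close>.

This equation has no comparison principle, but its derivative
\<open>- \<epsilon> w'' + H(w)' + g(w) = K g(w)\<close> has one. With \<open>\<lambda> = \<epsilon> k^2\<close>, moving \<open>H(w)' + g(w)\<close> to the
right, adding \<open>\<lambda> w\<close> on both sides and inverting \<open>\<lambda> - \<epsilon> d^2/dx^2\<close> turns it into \<open>w = step w\<close>, where \<open>step\<close> is built from averages against
exponential distributions. For large \<open>k\<close> (\<open>relaxation_rate_exists\<close>) \<open>step\<close> preserves the order, commutes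
with translations and fixes constants. Hence monotone iteration solves \<open>w = step w\<close> on a
bounded window, with \<open>w = a\<close> to the left of it and \<open>w = b\<close> to the right (\<open>truncated_exists\<close>).

What remains is to let the window grow, the solutions being translated so that they pass
the middle value at \<open>0\<close> (\<open>truncated_centred_exists\<close>). Monotone functions have pointwise limits by
Helly's theorem; the danger is that such a limit joins the wrong constants, or that an end of the window
stays at finite distance. The conserved quantity \<open>flux\<close>, an average of \<open>\<epsilon> w' + K' g(w) - H(w)\<close> with derivative
\<open>\<lambda> (step w - w)\<close>, excludes both. For a truncated solution it rises from \<open>0\<close> on the left of the window, is
constant inside, and falls to \<open>0\<close> on the right; so it is nonnegative, and so is the flux of the
limit. At \<open>\<plusminus>\<infinity>\<close> the latter is \<open>- H\<close> of the end states, which is therefore zero, and the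
end states are \<open>a\<close> and \<open>b\<close>. Moreover one end of the window escapes to infinity, so that the flux of the
limit is monotone; as it tends to \<open>0\<close> on both sides, it vanishes, and \<open>w = step w\<close> everywhere
(\<open>profile_exists\<close>). The averages in \<open>step\<close> gain derivatives, which makes \<open>w\<close> and \<open>V\<close> smooth enough
(\<open>regular_profile_exists\<close>).
\<close>

section \<open>One-sided exponential averages\<close>

definition bounded_borel :: "(real \<Rightarrow> real) \<Rightarrow> bool" where
  "bounded_borel p \<longleftrightarrow> p \<in> borel_measurable borel \<and> (\<exists>M. \<forall>x. \<bar>p x\<bar> \<le> M)"

abbreviation expo :: "real \<Rightarrow> real measure" where
  "expo k \<equiv> density lborel (exponential_density k)"

text \<open>
The symmetric kernel \<open>k exp (- k \<bar>x\<bar>) / 2\<close> is the half-sum of the two one-sided ones, and its derivative is a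
multiple of their difference. Working with the halves separately makes every derivative
below an instance of \<open>p \<mapsto> \<plusminus> k (p - mean of p)\<close>. Writing them as expectations gives dominated
convergence and monotonicity from the theory of probability measures.
\<close>

definition past_mean :: "real \<Rightarrow> (real \<Rightarrow> real) \<Rightarrow> real \<Rightarrow> real" where
  "past_mean k p x = (\<integral>s. p (x - s) \<partial>expo k)"

definition future_mean :: "real \<Rightarrow> (real \<Rightarrow> real) \<Rightarrow> real \<Rightarrow> real" where
  "future_mean k p x = (\<integral>s. p (x + s) \<partial>expo k)"

lemma bounded_borelI:
  assumes "p \<in> borel_measurable borel" "\<And>x. \<bar>p x\<bar> \<le> M"
  shows "bounded_borel p"
  using assms unfolding bounded_borel_def by blast

lemma bounded_borel_measurable [measurable_dest]:
  "bounded_borel p \<Longrightarrow> p \<in> borel_measurable borel"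
  unfolding bounded_borel_def by blast

lemma bounded_borel_lincomb:
  assumes "bounded_borel p" "bounded_borel q"
  shows "bounded_borel (\<lambda>x. \<alpha> * p x + \<beta> * q x)"
proof -
  obtain M N where M: "\<And>x. \<bar>p x\<bar> \<le> M" "\<And>x. \<bar>q x\<bar> \<le> N"
    using assms unfolding bounded_borel_def by blast
  show ?thesis
  proof (rule bounded_borelI)
    show "(\<lambda>x. \<alpha> * p x + \<beta> * q x) \<in> borel_measurable borel"
      using assms[THEN bounded_borel_measurable] by measurable
    fix x
    have "\<bar>\<alpha> * p x + \<beta> * q x\<bar> \<le> \<bar>\<alpha>\<bar> * \<bar>p x\<bar> + \<bar>\<beta>\<bar> * \<bar>q x\<bar>"
      by (metis abs_mult abs_triangle_ineq)
    also have "\<dots> \<le> \<bar>\<alpha>\<bar> * M + \<bar>\<beta>\<bar> * N"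
      using M by (intro add_mono mult_left_mono) auto
    finally show "\<bar>\<alpha> * p x + \<beta> * q x\<bar> \<le> \<bar>\<alpha>\<bar> * M + \<bar>\<beta>\<bar> * N" .
  qed
qed

lemma bounded_borel_reflect:
  assumes "bounded_borel p" shows "bounded_borel (\<lambda>x. p (- x))"
  using assms unfolding bounded_borel_def by (auto intro: measurable_compose[of uminus])

lemma bounded_borel_integrable_expo:
  assumes k: "k > 0" and p: "bounded_borel p"
  shows "integrable (expo k) (\<lambda>s. p (x - s))" "integrable (expo k) (\<lambda>s. p (x + s))"
proof -
  interpret E: prob_space "expo k" using prob_space_exponential_density[OF k] .
  note [measurable] = bounded_borel_measurable[OF p]
  obtain M where M: "\<And>x. \<bar>p x\<bar> \<le> M" using p unfolding bounded_borel_def by blast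
  show "integrable (expo k) (\<lambda>s. p (x - s))" "integrable (expo k) (\<lambda>s. p (x + s))"
    by (rule E.integrable_const_bound[where B=M], use M in auto)+
qed

lemma future_mean_reflect: "future_mean k p x = past_mean k (\<lambda>t. p (- t)) (- x)"
  unfolding future_mean_def past_mean_def by (simp add: add.commute)

lemma past_mean_const:
  assumes "k > 0" shows "past_mean k (\<lambda>_. c) x = c"
proof -
  interpret E: prob_space "expo k" using prob_space_exponential_density[OF assms] .
  show ?thesis unfolding past_mean_def using E.prob_space by simp
qed

lemma future_mean_const:
  assumes "k > 0" shows "future_mean k (\<lambda>_. c) x = c"
  using past_mean_const[OF assms] by (simp add: future_mean_reflect)

lemma past_mean_lincomb:
  assumes "k > 0" "bounded_borel p" "bounded_borel q"
  shows "past_mean k (\<lambda>x. \<alpha> * p x + \<beta> * q x) x = \<alpha> * past_mean k p x + \<beta> * past_mean k q x"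
  unfolding past_mean_def using bounded_borel_integrable_expo(1)[of k] assms by simp

lemma future_mean_lincomb:
  assumes "k > 0" "bounded_borel p" "bounded_borel q"
  shows "future_mean k (\<lambda>x. \<alpha> * p x + \<beta> * q x) x = \<alpha> * future_mean k p x + \<beta> * future_mean k q x"
  unfolding future_mean_def using bounded_borel_integrable_expo(2)[of k] assms by simp

lemma past_mean_mono:
  assumes "k > 0" "bounded_borel p" "bounded_borel q" "\<And>s. s \<ge> 0 \<Longrightarrow> p (x - s) \<le> q (y - s)"
  shows "past_mean k p x \<le> past_mean k q y"
proof -
  have "AE s in expo k. s \<ge> 0"
    by (subst AE_density) (auto simp: exponential_density_def)
  then have "AE s in expo k. p (x - s) \<le> q (y - s)"
    by eventually_elim (rule assms(4))
  then show ?thesis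
    unfolding past_mean_def
    by (intro integral_mono_AE bounded_borel_integrable_expo(1) assms)
qed

lemma future_mean_mono:
  assumes "k > 0" "bounded_borel p" "bounded_borel q" "\<And>s. s \<ge> 0 \<Longrightarrow> p (x + s) \<le> q (y + s)"
  shows "future_mean k p x \<le> future_mean k q y"
  unfolding future_mean_reflect
  by (rule past_mean_mono) (use assms bounded_borel_reflect in \<open>auto simp: add.commute\<close>)

lemma past_mean_shift: "past_mean k (\<lambda>t. p (t + y)) x = past_mean k p (x + y)"
  unfolding past_mean_def by (simp add: algebra_simps)

lemma future_mean_shift: "future_mean k (\<lambda>t. p (t + y)) x = future_mean k p (x + y)"
  unfolding future_mean_def by (simp add: algebra_simps)

lemma AE_expo_off_countable:
  assumes "countable (C :: real set)"
  shows "AE s in expo k. s \<notin> C"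
proof -
  have "AE s in lborel. s \<notin> C"
    by (rule AE_not_in) (use countable_imp_null_set_lborel[OF assms] in simp)
  then show ?thesis by (subst AE_density) auto
qed

text \<open>
The exceptional set \<open>C\<close> is there for limits supplied by Helly's theorem, which converge at continuity points.
\<close>

lemma past_mean_dominated:
  assumes k: "k > 0" and p: "\<And>n. p n \<in> borel_measurable borel" and M: "\<And>n x. \<bar>p n x\<bar> \<le> M"
    and q: "q \<in> borel_measurable borel"
    and C: "countable C" and lim: "\<And>x. x \<notin> C \<Longrightarrow> (\<lambda>n. p n x) \<longlonglongrightarrow> q x"
  shows "(\<lambda>n. past_mean k (p n) x) \<longlonglongrightarrow> past_mean k q x"
proof -
  interpret E: prob_space "expo k" using prob_space_exponential_density[OF k] .
  note [measurable] = p q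
  have "countable ((\<lambda>t. x - t) ` C)" using C by simp
  then have "AE s in expo k. s \<notin> (\<lambda>t. x - t) ` C" by (rule AE_expo_off_countable)
  then have ae: "AE s in expo k. (\<lambda>n. p n (x - s)) \<longlonglongrightarrow> q (x - s)"
  proof eventually_elim
    case (elim s)
    have "x - s \<notin> C"
    proof
      assume "x - s \<in> C"
      then have "x - (x - s) \<in> (\<lambda>t. x - t) ` C" by blast
      then show False using elim by simp
    qed
    then show ?case by (rule lim)
  qed
  show ?thesis
    unfolding past_mean_def
    by (rule integral_dominated_convergence[where w="\<lambda>_. M"]) (use ae M in auto)
qed

lemma future_mean_dominated:
  assumes k: "k > 0" and p: "\<And>n. p n \<in> borel_measurable borel" and M: "\<And>n x. \<bar>p n x\<bar> \<le> M"
    and q: "q \<in> borel_measurable borel"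
    and C: "countable C" and lim: "\<And>x. x \<notin> C \<Longrightarrow> (\<lambda>n. p n x) \<longlonglongrightarrow> q x"
  shows "(\<lambda>n. future_mean k (p n) x) \<longlonglongrightarrow> future_mean k q x"
  unfolding future_mean_reflect
proof (rule past_mean_dominated[where C="uminus ` C" and M=M])
  show "(\<lambda>t. p n (- t)) \<in> borel_measurable borel" for n
    using p by (auto intro: measurable_compose[of uminus])
  show "(\<lambda>t. q (- t)) \<in> borel_measurable borel"
    using q by (auto intro: measurable_compose[of uminus])
  show "(\<lambda>n. p n (- t)) \<longlonglongrightarrow> q (- t)" if "t \<notin> uminus ` C" for t
    by (rule lim) (use that in force)
qed (use k M C in auto)

lemma past_mean_tendsto:
  assumes k: "k > 0" and p: "bounded_borel p"
  shows "(p \<longlongrightarrow> l) at_top \<Longrightarrow> (past_mean k p \<longlongrightarrow> l) at_top"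
    and "(p \<longlongrightarrow> l) at_bot \<Longrightarrow> (past_mean k p \<longlongrightarrow> l) at_bot"
proof -
  interpret E: prob_space "expo k" using prob_space_exponential_density[OF k] .
  note [measurable] = bounded_borel_measurable[OF p]
  obtain M where M: "\<And>x. \<bar>p x\<bar> \<le> M" using p unfolding bounded_borel_def by blast
  have l: "(\<integral>s. l \<partial>expo k) = l"
    using past_mean_const[OF k] unfolding past_mean_def .
  show "(past_mean k p \<longlongrightarrow> l) at_top" if "(p \<longlongrightarrow> l) at_top"
  proof -
    have "((\<lambda>x. p (x - s)) \<longlongrightarrow> l) at_top" for s
      by (rule filterlim_compose[OF that])
        (use filterlim_tendsto_add_at_top[OF tendsto_const[of "- s"] filterlim_ident] in simp)
    then have "((\<lambda>x. \<integral>s. p (x - s) \<partial>expo k) \<longlongrightarrow> (\<integral>s. l \<partial>expo k)) at_top"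
      by (intro integral_dominated_convergence_at_top[where w="\<lambda>_. M"]) (use M in auto)
    then show ?thesis unfolding past_mean_def[abs_def] l .
  qed
  show "(past_mean k p \<longlongrightarrow> l) at_bot" if "(p \<longlongrightarrow> l) at_bot"
  proof -
    have "((\<lambda>x. p (- x - s)) \<longlongrightarrow> l) at_top" for s
      by (rule filterlim_compose[OF that])
        (use filterlim_tendsto_add_at_top[OF tendsto_const[of s] filterlim_ident] in
          \<open>simp add: filterlim_uminus_at_bot add.commute\<close>)
    then have "((\<lambda>x. \<integral>s. p (- x - s) \<partial>expo k) \<longlongrightarrow> (\<integral>s. l \<partial>expo k)) at_top"
      by (intro integral_dominated_convergence_at_top[where w="\<lambda>_. M"]) (use M in auto)
    then show ?thesis unfolding past_mean_def[abs_def] at_bot_mirror filterlim_filtermap l .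
  qed
qed

lemma future_mean_tendsto:
  assumes k: "k > 0" and p: "bounded_borel p"
  shows "(p \<longlongrightarrow> l) at_top \<Longrightarrow> (future_mean k p \<longlongrightarrow> l) at_top"
    and "(p \<longlongrightarrow> l) at_bot \<Longrightarrow> (future_mean k p \<longlongrightarrow> l) at_bot"
proof -
  note r = past_mean_tendsto[OF k bounded_borel_reflect[OF p], of l]
  show "(future_mean k p \<longlongrightarrow> l) at_top" if "(p \<longlongrightarrow> l) at_top"
    using r(2) that unfolding future_mean_reflect[abs_def] at_bot_mirror filterlim_filtermap by simp
  show "(future_mean k p \<longlongrightarrow> l) at_bot" if "(p \<longlongrightarrow> l) at_bot"
    using r(1) that unfolding future_mean_reflect[abs_def] at_bot_mirror filterlim_filtermap by simp
qed

text \<open>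
The average is \<open>exp (- k x)\<close> times the integral of \<open>k exp (k t) p t\<close> over \<open>t \<le> x\<close>, so the product
rule and the fundamental theorem of calculus apply. Differentiability needs continuity of \<open>p\<close>
at the single point \<open>x\<close>: truncated profiles jump at the ends of their window.
\<close>

lemma past_mean_cont_deriv:
  assumes k: "k > 0" and p: "bounded_borel p"
  shows "isCont (past_mean k p) x"
    and "isCont p x \<Longrightarrow> (past_mean k p has_real_derivative k * (p x - past_mean k p x)) (at x)"
proof -
  note pm [measurable] = bounded_borel_measurable[OF p]
  define h where "h t = k * exp (k * t) * p t" for t
  have hm [measurable]: "h \<in> borel_measurable borel" unfolding h_def[abs_def] by measurable
  have rep: "past_mean k p y = exp (- k * y) * (LBINT t:{..y}. h t)"
    and int: "set_integrable lborel {..y} h" for y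
  proof -
    have e: "exponential_density k (y - t) * p t = exp (- k * y) * (indicator {..y} t *\<^sub>R h t)" for t
      unfolding exponential_density_def h_def
      by (auto split: split_indicator simp: exp_diff exp_minus field_simps simp flip: exp_add)
    have cancel: "exp (k * y) * (exp (- k * y) * c) = c" for c :: real
      by (simp add: exp_minus)
    have "integrable lborel (\<lambda>s. exponential_density k s *\<^sub>R p (y - s))"
      using bounded_borel_integrable_expo(1)[OF k p, of y] k
      by (subst (asm) integrable_density) (auto simp: exponential_density_nonneg)
    then have "integrable lborel (\<lambda>t. exponential_density k (y + (-1) * t) *\<^sub>R p (y - (y + (-1) * t)))"
      by (rule lborel_integrable_real_affine) simp
    then have "integrable lborel (\<lambda>t. exp (- k * y) * (indicator {..y} t *\<^sub>R h t))"
      by (simp add: e)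
    then have "integrable lborel (\<lambda>t. exp (k * y) * (exp (- k * y) * (indicator {..y} t *\<^sub>R h t)))"
      by (rule integrable_mult_right)
    then show "set_integrable lborel {..y} h"
      unfolding set_integrable_def by (simp only: cancel)
    have "past_mean k p y = (\<integral>s. exponential_density k s *\<^sub>R p (y - s) \<partial>lborel)"
      unfolding past_mean_def
      by (subst integral_density) (auto simp: exponential_density_nonneg k)
    also have "\<dots> = (\<integral>t. exponential_density k (y + (-1) * t) *\<^sub>R p (y - (y + (-1) * t)) \<partial>lborel)"
      by (subst lborel_integral_real_affine[where c="-1" and t=y]) auto
    also have "\<dots> = (\<integral>t. exp (- k * y) * (indicator {..y} t *\<^sub>R h t) \<partial>lborel)"
      by (simp add: e)
    finally show "past_mean k p y = exp (- k * y) * (LBINT t:{..y}. h t)"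
      unfolding set_lebesgue_integral_def by simp
  qed
  \<comment> \<open>Splitting off the integral up to \<open>x0 < x\<close> leaves an integral over a compact interval.\<close>
  define x0 where "x0 = x - 1"
  have int2: "set_integrable lborel {x0..y} h" for y
    by (rule set_integrable_subset[OF int[of y]]) auto
  have G: "past_mean k p y = exp (- k * y) * ((LBINT t:{..x0}. h t) + integral {x0..y} h)" if "x0 \<le> y" for y
  proof -
    have "(LBINT t:{..y}. h t) = (LBINT t:{..x0} \<union> {x0<..y}. h t)"
      using that by (intro arg_cong[where f="\<lambda>S. LBINT t:S. h t"]) auto
    also have "\<dots> = (LBINT t:{..x0}. h t) + (LBINT t:{x0<..y}. h t)"
      by (rule set_integral_Un) (auto intro: int set_integrable_subset[OF int[of y]])
    also have "(LBINT t:{x0<..y}. h t) = (LBINT t:{x0..y}. h t)"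
      unfolding set_lebesgue_integral_def
    proof (rule integral_cong_AE)
      show "AE t in lborel. indicator {x0<..y} t *\<^sub>R h t = indicator {x0..y} t *\<^sub>R h t"
        using AE_lborel_singleton[of x0] by eventually_elim (auto split: split_indicator)
    qed auto
    also have "\<dots> = integral {x0..y} h" by (rule set_borel_integral_eq_integral(2)[OF int2])
    finally show ?thesis using rep by simp
  qed
  have ev: "eventually (\<lambda>y. exp (- k * y) * ((LBINT t:{..x0}. h t) + integral {x0..y} h) = past_mean k p y) (nhds x)"
  proof -
    have "eventually (\<lambda>y. y \<in> {x0<..}) (nhds x)" by (rule eventually_nhds_in_open) (auto simp: x0_def)
    then show ?thesis by eventually_elim (auto simp: G)
  qed
  have hi: "h integrable_on {x0..x+1}" by (rule set_borel_integral_eq_integral(1)[OF int2])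
  have xin: "x \<in> interior {x0..x+1}" unfolding x0_def by simp
  have "continuous_on {x0..x+1} (\<lambda>y. integral {x0..y} h)"
    by (rule indefinite_integral_continuous_1[OF hi])
  then have c: "isCont (\<lambda>y. integral {x0..y} h) x"
    using continuous_on_interior[OF _ xin] by blast
  have "isCont (\<lambda>y. exp (- k * y) * ((LBINT t:{..x0}. h t) + integral {x0..y} h)) x"
    by (intro continuous_intros c)
  then show "isCont (past_mean k p) x"
    using isCont_cong[OF ev] by simp
  assume px: "isCont p x"
  have "((\<lambda>u. integral {x0..u} h) has_vector_derivative h x) (at x within ({x0..x+1} - {}))"
  proof (rule integral_has_vector_derivative_continuous_at[OF hi])
    have "isCont h x" unfolding h_def[abs_def] by (intro continuous_intros px)
    then show "continuous (at x within {x0..x+1} - {}) h" by (rule continuous_at_imp_continuous_at_within)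
  qed (auto simp: x0_def)
  then have "((\<lambda>u. integral {x0..u} h) has_vector_derivative h x) (at x)"
    using at_within_interior[OF xin] by simp
  then have d: "((\<lambda>u. integral {x0..u} h) has_real_derivative h x) (at x)"
    by (simp add: has_real_derivative_iff_has_vector_derivative)
  have "((\<lambda>y. exp (- k * y) * ((LBINT t:{..x0}. h t) + integral {x0..y} h)) has_real_derivative
     (k * (p x - exp (- k * x) * ((LBINT t:{..x0}. h t) + integral {x0..x} h)))) (at x)"
    by (auto intro!: derivative_eq_intros d simp: h_def algebra_simps exp_minus)
  then show "(past_mean k p has_real_derivative k * (p x - past_mean k p x)) (at x)"
    using G[of x] DERIV_cong_ev[OF refl ev refl] by (simp add: x0_def)
qed

lemma future_mean_cont_deriv:
  assumes k: "k > 0" and p: "bounded_borel p"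
  shows "isCont (future_mean k p) x"
    and "isCont p x \<Longrightarrow> (future_mean k p has_real_derivative k * (future_mean k p x - p x)) (at x)"
proof -
  note r = past_mean_cont_deriv[OF k bounded_borel_reflect[OF p], of "- x"]
  show "isCont (future_mean k p) x"
    unfolding future_mean_reflect[abs_def] by (rule isCont_o2[where f=uminus, OF _ r(1)]) simp
  assume "isCont p x"
  then have "isCont (\<lambda>t. p (- t)) (- x)" by (intro isCont_o2[where f=uminus and a="- x" and g=p]) simp_all
  from r(2)[OF this]
  have "((\<lambda>y. past_mean k (\<lambda>t. p (- t)) (- y)) has_real_derivative
      (k * (p (- (- x)) - past_mean k (\<lambda>t. p (- t)) (- x))) * (- 1)) (at x)"
    by (rule DERIV_chain2) (auto intro!: derivative_eq_intros)
  then show "(future_mean k p has_real_derivative k * (future_mean k p x - p x)) (at x)"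
    unfolding future_mean_reflect[abs_def] by (simp add: algebra_simps)
qed

lemma bounded_borel_past_mean:
  assumes k: "k > 0" and p: "bounded_borel p"
  shows "bounded_borel (past_mean k p)"
proof -
  obtain M where M: "\<And>x. \<bar>p x\<bar> \<le> M" using p unfolding bounded_borel_def by blast
  have c: "bounded_borel (\<lambda>_. c)" for c by (rule bounded_borelI[of _ "\<bar>c\<bar>"]) auto
  show ?thesis
  proof (rule bounded_borelI)
    show "past_mean k p \<in> borel_measurable borel"
      using past_mean_cont_deriv(1)[OF k p]
      by (intro borel_measurable_continuous_onI continuous_at_imp_continuous_on) auto
    fix x
    have "past_mean k (\<lambda>_. - M) x \<le> past_mean k p x"
      by (rule past_mean_mono[OF k c p]) (use M in \<open>simp add: abs_le_iff minus_le_iff\<close>)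
    moreover have "past_mean k p x \<le> past_mean k (\<lambda>_. M) x"
      by (rule past_mean_mono[OF k p c]) (use M in \<open>simp add: abs_le_iff\<close>)
    ultimately show "\<bar>past_mean k p x\<bar> \<le> M" by (simp add: past_mean_const[OF k])
  qed
qed

lemma bounded_borel_future_mean:
  assumes k: "k > 0" and p: "bounded_borel p"
  shows "bounded_borel (future_mean k p)"
  using bounded_borel_reflect[OF bounded_borel_past_mean[OF k bounded_borel_reflect[OF p]]]
  unfolding future_mean_reflect[abs_def] .

section \<open>The monotone fixed point formulation\<close>

text \<open>
The two monotonicity hypotheses on \<open>s - g s / (\<epsilon> k\<^sup>2) \<plusminus> H s / (\<epsilon> k)\<close> express that \<open>k\<close> is large. They are the
analogue of the subcharacteristic condition of relaxation schemes: the linear part of each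
one-sided contribution dominates the transport term \<open>H\<close> and the damping \<open>g\<close>.
\<close>

locale viscous_profile =
  fixes a b \<epsilon> k :: real and g H :: "real \<Rightarrow> real"
  assumes ab: "a < b" and eps: "0 < \<epsilon>" and k: "0 < k"
    and g_cont: "continuous_on UNIV g" and H_cont: "continuous_on UNIV H"
    and g_mono: "mono_on {a..b} g"
    and plus_mono: "mono_on {a..b} (\<lambda>s. s - g s / (\<epsilon> * k\<^sup>2) + H s / (\<epsilon> * k))"
    and minus_mono: "mono_on {a..b} (\<lambda>s. s - g s / (\<epsilon> * k\<^sup>2) - H s / (\<epsilon> * k))"
    and H_ends: "H a = 0" "H b = 0" and H_pos: "\<And>s. a < s \<Longrightarrow> s < b \<Longrightarrow> 0 < H s"
begin

definition profile :: "(real \<Rightarrow> real) \<Rightarrow> bool" where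
  "profile w \<longleftrightarrow> mono w \<and> (\<forall>x. w x \<in> {a..b})"

definition mean_g :: "(real \<Rightarrow> real) \<Rightarrow> real \<Rightarrow> real" where
  "mean_g w x = (past_mean k (\<lambda>t. g (w t)) x + future_mean k (\<lambda>t. g (w t)) x) / 2"

text \<open>
With \<open>N\<close> the kernel of \<open>(\<epsilon> k\<^sup>2 - \<epsilon> d^2/dx^2)^{-1}\<close>, this is
\<open>N * (\<epsilon> k\<^sup>2 w - g(w)) - N' * H(w) + K N * g(w)\<close>, sorted by the two one-sided averages. Applying
\<open>K\<close> last, to the continuous function \<open>mean_g w = \<epsilon> k\<^sup>2 N * g(w)\<close>, lets \<open>flux_deriv\<close> hold
without any exchange of convolutions.
\<close>

definition step :: "(real \<Rightarrow> real) \<Rightarrow> real \<Rightarrow> real" where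
  "step w x =
     (past_mean k (\<lambda>t. w t - g (w t) / (\<epsilon> * k\<^sup>2) + H (w t) / (\<epsilon> * k)) x
      + future_mean k (\<lambda>t. w t - g (w t) / (\<epsilon> * k\<^sup>2) - H (w t) / (\<epsilon> * k)) x) / 2
     + (past_mean 1 (mean_g w) x + future_mean 1 (mean_g w) x) / (2 * (\<epsilon> * k\<^sup>2))"

text \<open>
The convolution of \<open>\<epsilon> w' + K' g(w) - H(w)\<close> with \<open>\<epsilon> k\<^sup>2 N\<close>, written without a derivative
of \<open>w\<close> so that it makes sense for profiles with jumps and passes to pointwise limits.
\<close>

definition flux :: "(real \<Rightarrow> real) \<Rightarrow> real \<Rightarrow> real" where
  "flux w x =
     (past_mean k (\<lambda>t. - H (w t) - \<epsilon> * k * w t) x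
      + future_mean k (\<lambda>t. - H (w t) + \<epsilon> * k * w t) x) / 2
     + (future_mean 1 (mean_g w) x - past_mean 1 (mean_g w) x) / 2"

lemma profileD:
  assumes "profile w" shows "mono w" "a \<le> w x" "w x \<le> b" "x \<le> y \<Longrightarrow> w x \<le> w y"
  using assms unfolding profile_def by (auto dest: monoD)

lemma profile_bound:
  assumes "continuous_on UNIV \<phi>"
  obtains M :: real where "\<And>w x. profile w \<Longrightarrow> \<bar>\<phi> (w x)\<bar> \<le> M"
proof -
  have "compact (\<phi> ` {a..b})"
    by (rule compact_continuous_image) (auto intro: continuous_on_subset[OF assms])
  then obtain M where "\<forall>y\<in>\<phi> ` {a..b}. norm y \<le> M"
    using compact_imp_bounded bounded_iff by metis
  then show ?thesis using that[of M] unfolding profile_def by auto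
qed

lemma profile_measurable:
  assumes "profile w" "continuous_on UNIV \<phi>"
  shows "(\<lambda>t. \<phi> (w t) :: real) \<in> borel_measurable borel"
  using borel_measurable_mono[OF profileD(1)[OF assms(1)]] borel_measurable_continuous_onI[OF assms(2)]
  by (rule measurable_compose)

lemma profile_bounded_borel:
  assumes "profile w" "continuous_on UNIV \<phi>"
  shows "bounded_borel (\<lambda>t. \<phi> (w t))"
  using profile_bound[OF assms(2)] bounded_borelI[OF profile_measurable[OF assms]] assms(1) by metis

lemma characteristic_cont:
  "continuous_on UNIV (\<lambda>s. s - g s / (\<epsilon> * k\<^sup>2) + H s / (\<epsilon> * k))"
  "continuous_on UNIV (\<lambda>s. s - g s / (\<epsilon> * k\<^sup>2) - H s / (\<epsilon> * k))"
  "continuous_on UNIV (\<lambda>s. - H s - \<epsilon> * k * s)"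
  "continuous_on UNIV (\<lambda>s. - H s + \<epsilon> * k * s)"
  using eps k by (auto intro!: continuous_intros g_cont H_cont)

lemmas profile_bb = profile_bounded_borel[OF _ g_cont]
  profile_bounded_borel[OF _ characteristic_cont(1)] profile_bounded_borel[OF _ characteristic_cont(2)]
  profile_bounded_borel[OF _ characteristic_cont(3)] profile_bounded_borel[OF _ characteristic_cont(4)]

lemma mean_g_alt: "mean_g w = (\<lambda>x. (1/2) * past_mean k (\<lambda>t. g (w t)) x + (1/2) * future_mean k (\<lambda>t. g (w t)) x)"
  unfolding mean_g_def by (auto simp: add_divide_distrib)

lemma mean_g_bounded_borel:
  assumes "profile w" shows "bounded_borel (mean_g w)"
  unfolding mean_g_alt
  by (intro bounded_borel_lincomb bounded_borel_past_mean bounded_borel_future_mean profile_bb k assms)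

lemma mean_g_cont:
  assumes "profile w" shows "isCont (mean_g w) x"
  unfolding mean_g_alt using past_mean_cont_deriv(1)[OF k profile_bb(1)[OF assms]]
    future_mean_cont_deriv(1)[OF k profile_bb(1)[OF assms]]
  by (intro continuous_intros)

lemma mean_g_le:
  assumes "profile w" "profile z" "\<And>s. w (x + s) \<le> z (y + s)"
  shows "mean_g w x \<le> mean_g z y"
proof -
  have le: "g (w (x + s)) \<le> g (z (y + s))" for s
    by (rule mono_onD[OF g_mono]) (use assms profileD in auto)
  have "past_mean k (\<lambda>t. g (w t)) x \<le> past_mean k (\<lambda>t. g (z t)) y"
    by (rule past_mean_mono) (use le[of "- s" for s] in \<open>auto intro: k profile_bb assms\<close>)
  moreover have "future_mean k (\<lambda>t. g (w t)) x \<le> future_mean k (\<lambda>t. g (z t)) y"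
    by (rule future_mean_mono) (use le in \<open>auto intro: k profile_bb assms\<close>)
  ultimately show ?thesis unfolding mean_g_def by simp
qed

text \<open>
Comparing \<open>w\<close> seen from \<open>x\<close> with \<open>z\<close> seen from \<open>y\<close> covers two facts at once: \<open>step\<close> preserves the order of
profiles (\<open>x = y\<close>), and it maps monotone functions to monotone functions (\<open>w = z\<close>).
\<close>

lemma step_le:
  assumes w: "profile w" "profile z" and le: "\<And>s. w (x + s) \<le> z (y + s)"
  shows "step w x \<le> step z y"
proof -
  have bnd: "w (x + s) \<in> {a..b}" "z (y + s) \<in> {a..b}" for s
    using w profileD by auto
  have "past_mean k (\<lambda>t. w t - g (w t) / (\<epsilon> * k\<^sup>2) + H (w t) / (\<epsilon> * k)) x
      \<le> past_mean k (\<lambda>t. z t - g (z t) / (\<epsilon> * k\<^sup>2) + H (z t) / (\<epsilon> * k)) y"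
  proof (rule past_mean_mono)
    fix s
    show "w (x - s) - g (w (x - s)) / (\<epsilon> * k\<^sup>2) + H (w (x - s)) / (\<epsilon> * k)
       \<le> z (y - s) - g (z (y - s)) / (\<epsilon> * k\<^sup>2) + H (z (y - s)) / (\<epsilon> * k)"
      using mono_onD[OF plus_mono bnd(1)[of "- s"] bnd(2)[of "- s"] le] by simp
  qed (intro k profile_bb w)+
  moreover have "future_mean k (\<lambda>t. w t - g (w t) / (\<epsilon> * k\<^sup>2) - H (w t) / (\<epsilon> * k)) x
      \<le> future_mean k (\<lambda>t. z t - g (z t) / (\<epsilon> * k\<^sup>2) - H (z t) / (\<epsilon> * k)) y"
  proof (rule future_mean_mono)
    fix s
    show "w (x + s) - g (w (x + s)) / (\<epsilon> * k\<^sup>2) - H (w (x + s)) / (\<epsilon> * k)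
       \<le> z (y + s) - g (z (y + s)) / (\<epsilon> * k\<^sup>2) - H (z (y + s)) / (\<epsilon> * k)"
      using mono_onD[OF minus_mono bnd(1)[of s] bnd(2)[of s] le] by simp
  qed (intro k profile_bb w)+
  moreover have g: "mean_g w (x + s) \<le> mean_g z (y + s)" for s
    by (rule mean_g_le[OF w]) (use le in \<open>simp add: add.assoc\<close>)
  have "past_mean 1 (mean_g w) x \<le> past_mean 1 (mean_g z) y"
    by (rule past_mean_mono) (use g[of "- s" for s] in \<open>auto intro: mean_g_bounded_borel w\<close>)
  moreover have "future_mean 1 (mean_g w) x \<le> future_mean 1 (mean_g z) y"
    by (rule future_mean_mono) (use g in \<open>auto intro: mean_g_bounded_borel w\<close>)
  ultimately show ?thesis unfolding step_def using eps k
    by (intro add_mono divide_right_mono) auto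
qed

lemma step_const: "step (\<lambda>_. c) x = c"
proof -
  have "mean_g (\<lambda>_. c) = (\<lambda>_. g c)"
    unfolding mean_g_def by (auto simp: past_mean_const[OF k] future_mean_const[OF k])
  then show ?thesis unfolding step_def using eps k
    by (simp add: past_mean_const future_mean_const field_simps)
qed

lemma profile_step:
  assumes w: "profile w" shows "profile (step w)"
proof -
  have c: "profile (\<lambda>_. a)" "profile (\<lambda>_. b)" unfolding profile_def using ab by (auto simp: mono_def)
  have "step (\<lambda>_. a) x \<le> step w x" "step w x \<le> step (\<lambda>_. b) x" for x
    by (rule step_le; use w c profileD in auto)+
  moreover have "mono (step w)"
    by (intro monoI step_le w) (use w profileD in auto)
  ultimately show ?thesis unfolding profile_def by (auto simp: step_const)
qed

lemma step_cont:
  assumes w: "profile w" shows "isCont (step w) x"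
  unfolding step_def[abs_def]
  by (intro continuous_intros past_mean_cont_deriv(1) future_mean_cont_deriv(1) profile_bb w k mean_g_bounded_borel)
     (use eps k in auto)

lemma flux_cont:
  assumes w: "profile w" shows "isCont (flux w) x"
  unfolding flux_def[abs_def]
  by (intro continuous_intros past_mean_cont_deriv(1) future_mean_cont_deriv(1) profile_bb w k mean_g_bounded_borel)
     auto

lemma mean_g_shift: "mean_g (\<lambda>t. w (t + y)) = (\<lambda>x. mean_g w (x + y))"
  unfolding mean_g_def using past_mean_shift[of k "\<lambda>t. g (w t)"] future_mean_shift[of k "\<lambda>t. g (w t)"] by auto

lemma step_shift: "step (\<lambda>t. w (t + y)) x = step w (x + y)"
  unfolding step_def mean_g_shift
  using past_mean_shift[of k "\<lambda>t. w t - g (w t) / (\<epsilon> * k\<^sup>2) + H (w t) / (\<epsilon> * k)"]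
    future_mean_shift[of k "\<lambda>t. w t - g (w t) / (\<epsilon> * k\<^sup>2) - H (w t) / (\<epsilon> * k)"]
  by (simp add: past_mean_shift future_mean_shift)

context
  fixes W :: "nat \<Rightarrow> real \<Rightarrow> real" and w :: "real \<Rightarrow> real" and C :: "real set"
  assumes W: "\<And>n. profile (W n)" and w: "profile w" and C: "countable C"
    and lim: "\<And>x. x \<notin> C \<Longrightarrow> (\<lambda>n. W n x) \<longlonglongrightarrow> w x"
begin

lemma mean_limit:
  assumes \<phi>: "continuous_on UNIV \<phi>" and c: "c > 0"
  shows "(\<lambda>n. past_mean c (\<lambda>t. \<phi> (W n t)) x) \<longlonglongrightarrow> past_mean c (\<lambda>t. \<phi> (w t)) x"
    and "(\<lambda>n. future_mean c (\<lambda>t. \<phi> (W n t)) x) \<longlonglongrightarrow> future_mean c (\<lambda>t. \<phi> (w t)) x"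
proof -
  obtain M :: real where M: "\<And>w x. profile w \<Longrightarrow> \<bar>\<phi> (w x)\<bar> \<le> M" using profile_bound[OF \<phi>] by metis
  have l: "(\<lambda>n. \<phi> (W n t)) \<longlonglongrightarrow> \<phi> (w t)" if "t \<notin> C" for t
    using \<phi> lim[OF that] continuous_on_tendsto_compose[OF \<phi>] by auto
  show "(\<lambda>n. past_mean c (\<lambda>t. \<phi> (W n t)) x) \<longlonglongrightarrow> past_mean c (\<lambda>t. \<phi> (w t)) x"
    by (rule past_mean_dominated[OF c _ _ _ C l]) (auto intro: profile_measurable \<phi> M W w)
  show "(\<lambda>n. future_mean c (\<lambda>t. \<phi> (W n t)) x) \<longlonglongrightarrow> future_mean c (\<lambda>t. \<phi> (w t)) x"
    by (rule future_mean_dominated[OF c _ _ _ C l]) (auto intro: profile_measurable \<phi> M W w)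
qed

lemma mean_g_limit: "(\<lambda>n. mean_g (W n) x) \<longlonglongrightarrow> mean_g w x"
  unfolding mean_g_def by (intro tendsto_intros mean_limit g_cont k) auto

lemma kernel_mean_g_limit:
  shows "(\<lambda>n. past_mean 1 (mean_g (W n)) x) \<longlonglongrightarrow> past_mean 1 (mean_g w) x"
    and "(\<lambda>n. future_mean 1 (mean_g (W n)) x) \<longlonglongrightarrow> future_mean 1 (mean_g w) x"
proof -
  have c: "mean_g (\<lambda>_. s) x = g s" for s x
    unfolding mean_g_def by (auto simp: past_mean_const[OF k] future_mean_const[OF k])
  have "profile (\<lambda>_. a)" "profile (\<lambda>_. b)" unfolding profile_def using ab by (auto simp: mono_def)
  then have "g a \<le> mean_g (W n) x" "mean_g (W n) x \<le> g b" for n x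
    using mean_g_le[of "\<lambda>_. a" "W n" x x] mean_g_le[of "W n" "\<lambda>_. b" x x] W profileD by (auto simp: c)
  then have M: "\<bar>mean_g (W n) x\<bar> \<le> max \<bar>g a\<bar> \<bar>g b\<bar>" for n x
    by (smt (verit))
  note m = mean_g_bounded_borel[THEN bounded_borel_measurable]
  show "(\<lambda>n. past_mean 1 (mean_g (W n)) x) \<longlonglongrightarrow> past_mean 1 (mean_g w) x"
    by (rule past_mean_dominated[where C="{}"]) (auto intro: m W w M mean_g_limit)
  show "(\<lambda>n. future_mean 1 (mean_g (W n)) x) \<longlonglongrightarrow> future_mean 1 (mean_g w) x"
    by (rule future_mean_dominated[where C="{}"]) (auto intro: m W w M mean_g_limit)
qed

lemma step_limit: "(\<lambda>n. step (W n) x) \<longlonglongrightarrow> step w x"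
  unfolding step_def
  by (intro tendsto_intros kernel_mean_g_limit mean_limit[OF characteristic_cont(1) k]
      mean_limit[OF characteristic_cont(2) k]) (use eps k in auto)

lemma flux_limit: "(\<lambda>n. flux (W n) x) \<longlonglongrightarrow> flux w x"
  unfolding flux_def
  by (intro tendsto_intros kernel_mean_g_limit mean_limit[OF characteristic_cont(3) k]
      mean_limit[OF characteristic_cont(4) k]) auto

end

text \<open>
Regrouped by linearity of the averages, \<open>step\<close> consists of the terms that differentiating \<open>flux\<close> produces.
\<close>

lemma step_alt:
  assumes w: "profile w"
  shows "\<epsilon> * k\<^sup>2 * step w x = k * (future_mean k (\<lambda>t. - H (w t) + \<epsilon> * k * w t) x
            - past_mean k (\<lambda>t. - H (w t) - \<epsilon> * k * w t) x) / 2
          + (past_mean 1 (mean_g w) x + future_mean 1 (mean_g w) x) / 2 - mean_g w x"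
proof -
  have l: "\<epsilon> * k\<^sup>2 \<noteq> 0" "\<epsilon> * k \<noteq> 0" using eps k by auto
  have 1: "(\<lambda>t. w t - g (w t) / (\<epsilon> * k\<^sup>2) + H (w t) / (\<epsilon> * k))
      = (\<lambda>t. (- 1 / (\<epsilon> * k)) * (- H (w t) - \<epsilon> * k * w t) + (- 1 / (\<epsilon> * k\<^sup>2)) * g (w t))"
    using l by (auto simp: field_simps)
  have 2: "(\<lambda>t. w t - g (w t) / (\<epsilon> * k\<^sup>2) - H (w t) / (\<epsilon> * k))
      = (\<lambda>t. (1 / (\<epsilon> * k)) * (- H (w t) + \<epsilon> * k * w t) + (- 1 / (\<epsilon> * k\<^sup>2)) * g (w t))"
    using l by (auto simp: field_simps)
  show ?thesis
    unfolding step_def 1 2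
      past_mean_lincomb[OF k profile_bb(4)[OF w] profile_bb(1)[OF w]]
      future_mean_lincomb[OF k profile_bb(5)[OF w] profile_bb(1)[OF w]] mean_g_def[of w x]
    using eps k by (simp add: field_simps power2_eq_square)
qed

text \<open>
The conservation law behind the construction: where \<open>step w\<close> differs from \<open>w\<close>, the
difference acts as a source of \<open>flux\<close>.
\<close>

lemma flux_deriv:
  assumes w: "profile w" and c: "isCont w x"
  shows "(flux w has_real_derivative \<epsilon> * k\<^sup>2 * (step w x - w x)) (at x)"
proof -
  have H: "isCont (\<lambda>t. H (w t)) x"
    by (rule isCont_o2[OF c, where g=H]) (use H_cont in \<open>simp add: continuous_on_eq_continuous_at\<close>)
  have c1: "isCont (\<lambda>t. - H (w t) - \<epsilon> * k * w t) x" "isCont (\<lambda>t. - H (w t) + \<epsilon> * k * w t) x"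
    by (intro continuous_intros c H)+
  note bb = profile_bb(4,5)[OF w] mean_g_bounded_borel[OF w]
  note d = DERIV_add[OF
      DERIV_cdivide[OF DERIV_add[OF past_mean_cont_deriv(2)[OF k bb(1) c1(1)] future_mean_cont_deriv(2)[OF k bb(2) c1(2)]], of 2]
      DERIV_cdivide[OF DERIV_diff[OF future_mean_cont_deriv(2)[OF zero_less_one bb(3) mean_g_cont[OF w]]
          past_mean_cont_deriv(2)[OF zero_less_one bb(3) mean_g_cont[OF w]]], of 2]]
  show ?thesis
    unfolding flux_def[abs_def] right_diff_distrib step_alt[OF w]
    by (rule DERIV_cong[OF d]) (simp add: field_simps power2_eq_square)
qed

lemma profile_tendsto:
  assumes w: "profile w"
  obtains l r where "(w \<longlongrightarrow> l) at_bot" "(w \<longlongrightarrow> r) at_top" "\<And>x. l \<le> w x" "\<And>x. w x \<le> r"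
    "l \<in> {a..b}" "r \<in> {a..b}"
proof -
  define l where "l = (INF x. w x)"
  define r where "r = (SUP x. w x)"
  have bd: "bdd_below (range w)" "bdd_above (range w)"
    using profileD(2,3)[OF w] by (auto intro!: bdd_belowI[of _ a] bdd_aboveI[of _ b])
  have l: "l \<le> w x" and r: "w x \<le> r" for x
    unfolding l_def r_def by (auto intro: cINF_lower cSUP_upper bd)
  have "(w \<longlongrightarrow> l) at_bot"
  proof (rule decreasing_tendsto)
    fix y assume "l < y"
    then obtain x where "w x < y" using cINF_less_iff[of UNIV w y] bd unfolding l_def by auto
    then show "\<forall>\<^sub>F x in at_bot. w x < y"
      unfolding eventually_at_bot_linorder using profileD(4)[OF w] by (meson le_less_trans)
  qed (use l in auto)
  moreover have "(w \<longlongrightarrow> r) at_top"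
  proof (rule increasing_tendsto)
    fix y assume "y < r"
    then obtain x where "y < w x" using less_cSUP_iff[of UNIV w y] bd unfolding r_def by auto
    then show "\<forall>\<^sub>F x in at_top. y < w x"
      unfolding eventually_at_top_linorder using profileD(4)[OF w] by (meson less_le_trans)
  qed (use r in auto)
  moreover have "l \<in> {a..b}" "r \<in> {a..b}"
    using l[of 0] r[of 0] profileD[OF w] unfolding l_def r_def
    by (auto intro!: cINF_greatest cSUP_least intro: order_trans)
  ultimately show ?thesis using l r that by blast
qed

lemma mean_g_tendsto:
  assumes w: "profile w"
  shows "(w \<longlongrightarrow> r) at_top \<Longrightarrow> (mean_g w \<longlongrightarrow> g r) at_top"
    and "(w \<longlongrightarrow> r) at_bot \<Longrightarrow> (mean_g w \<longlongrightarrow> g r) at_bot"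
proof -
  have g: "((\<lambda>t. g (w t)) \<longlongrightarrow> g r) F" if "(w \<longlongrightarrow> r) F" for F
    using continuous_on_tendsto_compose[OF g_cont that] by auto
  show "(mean_g w \<longlongrightarrow> g r) at_top" if "(w \<longlongrightarrow> r) at_top"
    unfolding mean_g_def[abs_def]
    by (rule tendsto_eq_intros past_mean_tendsto(1) future_mean_tendsto(1) k profile_bb w g that refl | simp)+
  show "(mean_g w \<longlongrightarrow> g r) at_bot" if "(w \<longlongrightarrow> r) at_bot"
    unfolding mean_g_def[abs_def]
    by (rule tendsto_eq_intros past_mean_tendsto(2) future_mean_tendsto(2) k profile_bb w g that refl | simp)+
qed

text \<open>
Near a constant state \<open>r\<close> the terms \<open>\<epsilon> w'\<close> and \<open>K' g(w)\<close> average out, which leaves \<open>- H r\<close>.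
\<close>

lemma flux_tendsto:
  assumes w: "profile w"
  shows "(w \<longlongrightarrow> r) at_top \<Longrightarrow> (flux w \<longlongrightarrow> - H r) at_top"
    and "(w \<longlongrightarrow> r) at_bot \<Longrightarrow> (flux w \<longlongrightarrow> - H r) at_bot"
proof -
  have H: "((\<lambda>t. H (w t)) \<longlongrightarrow> H r) F" if "(w \<longlongrightarrow> r) F" for F
    using continuous_on_tendsto_compose[OF H_cont that] by auto
  have c: "((\<lambda>t. - H (w t) - \<epsilon> * k * w t) \<longlongrightarrow> - H r - \<epsilon> * k * r) F"
    "((\<lambda>t. - H (w t) + \<epsilon> * k * w t) \<longlongrightarrow> - H r + \<epsilon> * k * r) F" if "(w \<longlongrightarrow> r) F" for F
    by (intro tendsto_intros H that)+
  note bb = profile_bb(4,5)[OF w] mean_g_bounded_borel[OF w]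
  show "(flux w \<longlongrightarrow> - H r) at_top" if t: "(w \<longlongrightarrow> r) at_top"
  proof -
    have "(flux w \<longlongrightarrow> ((- H r - \<epsilon> * k * r) + (- H r + \<epsilon> * k * r)) / 2 + (g r - g r) / 2) at_top"
      unfolding flux_def[abs_def]
      by (intro tendsto_intros past_mean_tendsto(1) future_mean_tendsto(1) k bb c t mean_g_tendsto(1) w) auto
    then show ?thesis by simp
  qed
  show "(flux w \<longlongrightarrow> - H r) at_bot" if t: "(w \<longlongrightarrow> r) at_bot"
  proof -
    have "(flux w \<longlongrightarrow> ((- H r - \<epsilon> * k * r) + (- H r + \<epsilon> * k * r)) / 2 + (g r - g r) / 2) at_bot"
      unfolding flux_def[abs_def]
      by (intro tendsto_intros past_mean_tendsto(2) future_mean_tendsto(2) k bb c t mean_g_tendsto(2) w) auto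
    then show ?thesis by simp
  qed
qed

section \<open>Profiles on growing windows and their limit\<close>

text \<open>
The values outside the window are imposed and may leave jumps at \<open>- A\<close> and \<open>B\<close>; the limit argument
uses only the sign of \<open>step z - z\<close> there, never a boundary condition.
\<close>

definition truncated :: "real \<Rightarrow> real \<Rightarrow> (real \<Rightarrow> real) \<Rightarrow> bool" where
  "truncated A B z \<longleftrightarrow> profile z \<and> (\<forall>x. x < - A \<longrightarrow> z x = a) \<and> (\<forall>x. B \<le> x \<longrightarrow> z x = b)
     \<and> (\<forall>x. - A \<le> x \<longrightarrow> x < B \<longrightarrow> z x = step z x)"

text \<open>
Monotone iteration from the lowest admissible function. The iterates increase and are
bounded by \<open>b\<close>, and \<open>step\<close> is continuous along their pointwise limit.
\<close>

lemma truncated_exists: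
  assumes L: "L > 0"
  obtains w where "truncated L L w"
proof -
  define cut where "cut h x = (if x < - L then a else if x < L then h x else b)" for h and x :: real
  define W where "W = rec_nat (\<lambda>x. if x < L then a else b) (\<lambda>_ h. cut (step h))"
  have W0: "W 0 = (\<lambda>x. if x < L then a else b)" and WS: "W (Suc j) = cut (step (W j))" for j
    unfolding W_def by auto
  have pcut: "profile (cut h)" if "profile h" for h
    using profileD[OF that] ab L unfolding profile_def cut_def by (auto simp: mono_def)
  have pW: "profile (W j)" for j
  proof (induction j)
    case 0
    show ?case using ab unfolding W0 profile_def by (auto simp: mono_def)
  next
    case (Suc j)
    show ?case unfolding WS by (intro pcut profile_step Suc)
  qed
  have inc: "W j x \<le> W (Suc j) x" for j x
  proof (induction j arbitrary: x)
    case 0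
    show ?case using profileD[OF profile_step[OF pW[of 0]]] ab L
      unfolding WS cut_def by (auto simp: W0)
  next
    case (Suc j)
    have "step (W j) x \<le> step (W (Suc j)) x" by (rule step_le[OF pW pW Suc])
    then show ?case unfolding WS[of "Suc j"] unfolding WS[of j] cut_def by (auto simp: WS cut_def)
  qed
  have "\<exists>l. (\<lambda>j. W j x) \<longlonglongrightarrow> l" for x
  proof -
    have "incseq (\<lambda>j. W j x)" by (rule incseq_SucI) (rule inc)
    then show ?thesis
      using incseq_convergent[of "\<lambda>j. W j x" b] profileD(3)[OF pW] by blast
  qed
  then obtain w where w: "\<And>x. (\<lambda>j. W j x) \<longlonglongrightarrow> w x" by metis
  have pw: "profile w"
    unfolding profile_def
  proof (intro conjI allI monoI)
    show "w x \<le> w y" if "x \<le> y" for x y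
      by (rule LIMSEQ_le[OF w w]) (use profileD(4)[OF pW that] in auto)
    show "w x \<in> {a..b}" for x
      using LIMSEQ_le_const[OF w[of x], of a] LIMSEQ_le_const2[OF w[of x], of b] profileD[OF pW] by auto
  qed
  have s: "(\<lambda>j. step (W j) x) \<longlonglongrightarrow> step w x" for x
    by (rule step_limit[where C="{}"]) (use pW pw w in auto)
  have "w x = cut (step w) x" for x
  proof (rule LIMSEQ_unique)
    show "(\<lambda>j. W (Suc j) x) \<longlonglongrightarrow> w x" by (rule LIMSEQ_Suc[OF w])
    show "(\<lambda>j. W (Suc j) x) \<longlonglongrightarrow> cut (step w) x" unfolding WS cut_def by (auto intro: s)
  qed
  then have "truncated L L w" unfolding truncated_def using pw L by (auto simp: cut_def)
  then show ?thesis by (rule that)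
qed

text \<open>
Translation by the point where the profile first reaches the middle value. This keeps the transition
in view when the window grows; the price is that the window need no longer be centred.
\<close>

lemma truncated_centred_exists:
  assumes L: "L > 0"
  shows "\<exists>z A B. 0 \<le> A \<and> 0 \<le> B \<and> A + B = 2 * L \<and> truncated A B z
     \<and> (\<forall>x<0. z x \<le> (a + b) / 2) \<and> (\<forall>x>0. (a + b) / 2 \<le> z x)"
proof -
  obtain w where tw: "truncated L L w" using truncated_exists[OF L] .
  then have pw: "profile w" unfolding truncated_def by simp
  define m where "m = (a + b) / 2"
  have m: "a < m" "m < b" using ab unfolding m_def by auto
  define S where "S = {x. m \<le> w x}"
  have LS: "L \<in> S" using tw m unfolding S_def truncated_def by auto
  have low: "- L \<le> x" if "x \<in> S" for x
    using tw m that unfolding S_def truncated_def by (metis linorder_not_less mem_Collect_eq)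
  define y where "y = Inf S"
  have bd: "bdd_below S" using low by (rule bdd_belowI)
  have y: "- L \<le> y" "y \<le> L"
    unfolding y_def using LS low bd by (auto intro: cInf_greatest cInf_lower)
  define z where "z x = w (x + y)" for x
  have "truncated (L + y) (L - y) z"
  proof -
    have "profile z" using profileD[OF pw] unfolding profile_def z_def by (auto simp: mono_def)
    moreover have "step z x = step w (x + y)" for x
      unfolding z_def by (rule step_shift)
    ultimately show ?thesis using tw unfolding truncated_def z_def by auto
  qed
  moreover have "z x \<le> m" if "x < 0" for x
  proof -
    have "x + y \<notin> S" using that cInf_lower[OF _ bd, of "x + y"] unfolding y_def by auto
    then show ?thesis unfolding S_def z_def by auto
  qed
  moreover have "m \<le> z x" if "x > 0" for x
  proof -
    have "S \<noteq> {}" using LS by blast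
    moreover have "Inf S < x + y" using that unfolding y_def by simp
    ultimately obtain t where "t \<in> S" "t < x + y" using cInf_lessD by blast
    then show ?thesis using profileD(4)[OF pw, of t "x + y"] unfolding S_def z_def by auto
  qed
  ultimately show ?thesis using y unfolding m_def
    by (intro exI[of _ z] exI[of _ "L + y"] exI[of _ "L - y"]) auto
qed

context
  fixes z A B assumes z: "truncated A B z" and AB: "- A \<le> B"
begin

lemma truncated_profile: "profile z"
  using z unfolding truncated_def by simp

lemma truncated_cont: "x \<noteq> - A \<Longrightarrow> x \<noteq> B \<Longrightarrow> isCont z x"
proof -
  assume x: "x \<noteq> - A" "x \<noteq> B"
  consider "x < - A" | "- A < x" "x < B" | "B < x" using x by linarith
  then show ?thesis
  proof cases
    case 1
    then have "\<forall>\<^sub>F t in nhds x. t \<in> {..< - A}" by (intro eventually_nhds_in_open) auto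
    then have "\<forall>\<^sub>F t in nhds x. z t = a"
      by eventually_elim (use z in \<open>auto simp: truncated_def\<close>)
    then show ?thesis using isCont_cong by force
  next
    case 2
    then have "\<forall>\<^sub>F t in nhds x. t \<in> {- A<..<B}" by (intro eventually_nhds_in_open) auto
    then have "\<forall>\<^sub>F t in nhds x. z t = step z t"
      by eventually_elim (use z in \<open>auto simp: truncated_def\<close>)
    then show ?thesis using isCont_cong step_cont[OF truncated_profile] by force
  next
    case 3
    then have "\<forall>\<^sub>F t in nhds x. t \<in> {B<..}" by (intro eventually_nhds_in_open) auto
    then have "\<forall>\<^sub>F t in nhds x. z t = b"
      by eventually_elim (use z in \<open>auto simp: truncated_def\<close>)
    then show ?thesis using isCont_cong by force
  qed
qed

lemma truncated_right_cont: "continuous (at_right x) z"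
proof -
  consider "x < - A" | "- A \<le> x" "x < B" | "B \<le> x" by linarith
  then show ?thesis
  proof cases
    case 1
    then show ?thesis using truncated_cont[of x] AB by (auto intro: continuous_at_imp_continuous_at_within)
  next
    case 2
    have "\<forall>\<^sub>F t in at_right x. t \<in> {x<..<B}" using 2 by (rule_tac eventually_at_right_real) auto
    then have ev: "\<forall>\<^sub>F t in at_right x. step z t = z t"
      by eventually_elim (use 2 z in \<open>auto simp: truncated_def\<close>)
    have "(step z \<longlongrightarrow> step z x) (at_right x)"
      using continuous_at_imp_continuous_at_within[OF step_cont[OF truncated_profile, of x]]
      unfolding continuous_within .
    then show ?thesis using Lim_transform_eventually[OF _ ev] 2 z
      by (auto simp: continuous_within truncated_def)
  next
    case 3
    have "\<forall>\<^sub>F t in at_right x. t \<in> {x<..<x+1}" by (rule eventually_at_right_real) auto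
    then have ev: "\<forall>\<^sub>F t in at_right x. b = z t"
      by eventually_elim (use 3 z in \<open>auto simp: truncated_def\<close>)
    show ?thesis using Lim_transform_eventually[OF tendsto_const ev] 3 z
      by (auto simp: continuous_within truncated_def)
  qed
qed

lemma truncated_flux_cont: "continuous_on S (flux z)"
  using flux_cont[OF truncated_profile] by (simp add: continuous_at_imp_continuous_on)

text \<open>
To the left of the window \<open>z = a\<close> is the smallest admissible value, so \<open>step z \<ge> z\<close>; to the right
the inequality is reversed.
\<close>

lemma truncated_flux_left:
  assumes "x \<le> y" "y \<le> - A" shows "flux z x \<le> flux z y"
proof (rule DERIV_nonneg_imp_increasing_open[OF assms(1) _ truncated_flux_cont])
  fix t assume t: "x < t" "t < y"
  then have "isCont z t" using assms AB by (intro truncated_cont) auto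
  moreover have "z t \<le> step z t"
    using z t assms profileD(2)[OF profile_step[OF truncated_profile]] unfolding truncated_def by auto
  ultimately show "\<exists>d. (flux z has_real_derivative d) (at t) \<and> d \<ge> 0"
    using flux_deriv[OF truncated_profile] eps k
    by (intro exI[of _ "\<epsilon> * k\<^sup>2 * (step z t - z t)"]) auto
qed

lemma truncated_flux_right:
  assumes "x \<le> y" "B \<le> x" shows "flux z y \<le> flux z x"
proof -
  have "- flux z x \<le> - flux z y"
  proof (rule DERIV_nonneg_imp_increasing_open[OF assms(1)])
    fix t assume t: "x < t" "t < y"
    then have "isCont z t" using assms AB by (intro truncated_cont) auto
    moreover have "step z t \<le> z t"
      using z t assms profileD(3)[OF profile_step[OF truncated_profile]] unfolding truncated_def by auto
    ultimately show "\<exists>d. ((\<lambda>x. - flux z x) has_real_derivative d) (at t) \<and> d \<ge> 0"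
      using DERIV_minus[OF flux_deriv[OF truncated_profile, of t]] eps k
      by (intro exI[of _ "- (\<epsilon> * k\<^sup>2 * (step z t - z t))"]) (auto intro!: mult_nonneg_nonpos)
  qed (intro continuous_intros truncated_flux_cont)
  then show ?thesis by simp
qed

lemma truncated_flux_middle:
  assumes "- A \<le> x" "x \<le> y" "y \<le> B" shows "flux z y = flux z x"
proof (cases "x = y")
  case False
  show ?thesis
  proof (rule DERIV_isconst_end[OF _ truncated_flux_cont])
    fix t assume t: "x < t" "t < y"
    then have "isCont z t" using assms by (intro truncated_cont) auto
    moreover have "step z t = z t" using z t assms unfolding truncated_def by auto
    ultimately show "(flux z has_real_derivative 0) (at t)"
      using flux_deriv[OF truncated_profile, of t] by simp
  qed (use False assms in auto)
qed auto

lemma truncated_flux_nondecreasing: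
  assumes "x \<le> y" "y \<le> B" shows "flux z x \<le> flux z y"
proof -
  consider "y \<le> - A" | "- A \<le> x" | "x \<le> - A" "- A \<le> y" by linarith
  then show ?thesis
  proof cases
    case 3
    then show ?thesis using truncated_flux_left[of x "- A"] truncated_flux_middle[of "- A" y] assms by simp
  qed (use truncated_flux_left[of x y] truncated_flux_middle[of x y] assms in auto)
qed

lemma truncated_flux_nonincreasing:
  assumes "x \<le> y" "- A \<le> x" shows "flux z y \<le> flux z x"
proof -
  consider "y \<le> B" | "B \<le> x" | "x \<le> B" "B \<le> y" by linarith
  then show ?thesis
  proof cases
    case 3
    then show ?thesis using truncated_flux_right[of B y] truncated_flux_middle[of x B] assms by simp
  qed (use truncated_flux_right[of x y] truncated_flux_middle[of x y] assms in auto)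
qed

text \<open>
The flux vanishes at both infinities because \<open>H a = H b = 0\<close>, and it is monotone on either
side of any point of the window.
\<close>

lemma truncated_flux_nonneg: "0 \<le> flux z x"
proof (cases "x \<le> B")
  case True
  have "\<forall>\<^sub>F t in at_bot. a = z t"
    using eventually_gt_at_bot[of "- A"] by eventually_elim (use z in \<open>auto simp: truncated_def\<close>)
  then have "(flux z \<longlongrightarrow> - H a) at_bot"
    by (intro flux_tendsto(2) truncated_profile Lim_transform_eventually[OF tendsto_const])
  moreover have "\<forall>\<^sub>F t in at_bot. flux z t \<le> flux z x"
    using eventually_le_at_bot[of x] by eventually_elim (use True truncated_flux_nondecreasing in auto)
  ultimately show ?thesis using tendsto_upperbound H_ends by fastforce
next
  case False
  have "\<forall>\<^sub>F t in at_top. b = z t"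
    using eventually_ge_at_top[of B] by eventually_elim (use z in \<open>auto simp: truncated_def\<close>)
  then have "(flux z \<longlongrightarrow> - H b) at_top"
    by (intro flux_tendsto(1) truncated_profile Lim_transform_eventually[OF tendsto_const])
  moreover have "\<forall>\<^sub>F t in at_top. flux z t \<le> flux z x"
    using eventually_ge_at_top[of x] by eventually_elim (use False AB truncated_flux_nonincreasing in auto)
  ultimately show ?thesis using tendsto_upperbound H_ends by fastforce
qed

end

text \<open>
Helly's theorem asks for values in a symmetric interval, hence the shift by the midpoint.
\<close>

lemma truncated_limit:
  assumes Z: "\<And>n. truncated (A n) (B n) (Z n)" and AB: "\<And>n. - A n \<le> B n"
  obtains s w C where "strict_mono (s :: nat \<Rightarrow> nat)" "profile w" "\<And>x. continuous (at_right x) w"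
    "countable C" "\<And>x. x \<notin> C \<Longrightarrow> isCont w x \<and> (\<lambda>n. Z (s n) x) \<longlonglongrightarrow> w x"
proof -
  define m where "m = (a + b) / 2"
  note pZ = truncated_profile[OF Z AB]
  have "\<exists>s. strict_mono (s::nat \<Rightarrow> nat) \<and> (\<exists>F. (\<forall>x. continuous (at_right x) F) \<and> mono F
     \<and> (\<forall>x. \<bar>F x\<bar> \<le> (b - a) / 2) \<and> (\<forall>x. continuous (at x) F \<longrightarrow> (\<lambda>n. Z (s n) x - m) \<longlonglongrightarrow> F x))"
  proof (rule Helly_selection)
    show "continuous (at_right x) (\<lambda>x. Z n x - m)" for n x
      by (intro continuous_intros truncated_right_cont[OF Z AB])
    show "mono (\<lambda>x. Z n x - m)" for n using profileD(1)[OF pZ] by (auto simp: mono_def)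
    show "\<bar>Z n x - m\<bar> \<le> (b - a) / 2" for n x
      using profileD(2,3)[OF pZ, of n x] unfolding m_def abs_le_iff by (auto simp: field_simps)
  qed
  then obtain s F where s: "strict_mono (s::nat \<Rightarrow> nat)" and F: "\<And>x. continuous (at_right x) F" "mono F"
     "\<And>x. \<bar>F x\<bar> \<le> (b - a) / 2" "\<And>x. isCont F x \<Longrightarrow> (\<lambda>n. Z (s n) x - m) \<longlonglongrightarrow> F x" by blast
  define w where "w x = F x + m" for x
  have "profile w"
    using F(2,3) unfolding profile_def w_def m_def abs_le_iff by (auto simp: mono_def field_simps)
  moreover have "continuous (at_right x) w" for x
    unfolding w_def[abs_def] by (intro continuous_intros F)
  moreover have "isCont w x \<and> (\<lambda>n. Z (s n) x) \<longlonglongrightarrow> w x" if "x \<notin> {x. \<not> isCont F x}" for x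
  proof -
    have c: "isCont F x" using that by simp
    have "isCont w x" unfolding w_def[abs_def] by (intro continuous_intros c)
    then show ?thesis using tendsto_add[OF F(4)[OF c] tendsto_const[of m]]
      by (simp add: w_def)
  qed
  ultimately show ?thesis using that[OF s _ _ mono_ctble_discont[OF F(2)]] by blast
qed

lemma countable_complement_meets:
  assumes "countable C" "x < (y :: real)"
  obtains t where "x < t" "t < y" "t \<notin> C"
proof -
  have "\<not> {x<..<y} \<subseteq> C"
    using uncountable_open_interval[of x y] assms countable_subset by blast
  then obtain t where "t \<in> {x<..<y}" "t \<notin> C" by blast
  then show ?thesis using that[of t] by simp
qed

lemma H_zero: "s \<in> {a..b} \<Longrightarrow> H s \<le> 0 \<Longrightarrow> s = a \<or> s = b"
  using H_pos[of s] by force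

lemma profile_exists:
  obtains w where "profile w" "(w \<longlongrightarrow> a) at_bot" "(w \<longlongrightarrow> b) at_top"
    "\<And>x. flux w x = 0" "\<And>x. step w x = w x"
proof -
  define m where "m = (a + b) / 2"
  have m: "a < m" "m < b" using ab unfolding m_def by auto
  have "\<exists>z A B. 0 \<le> A \<and> 0 \<le> B \<and> A + B = 2 * real (Suc n) \<and> truncated A B z
     \<and> (\<forall>x<0. z x \<le> m) \<and> (\<forall>x>0. m \<le> z x)" for n
    unfolding m_def by (rule truncated_centred_exists) simp
  then obtain Z A B where AB0: "\<And>n. 0 \<le> A n" "\<And>n. 0 \<le> B n" "\<And>n. A n + B n = 2 * real (Suc n)"
     and Z: "\<And>n. truncated (A n) (B n) (Z n)"
     and Zm: "\<And>n x. x < 0 \<Longrightarrow> Z n x \<le> m" "\<And>n x. x > 0 \<Longrightarrow> m \<le> Z n x" by metis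
  have AB: "- A n \<le> B n" for n using AB0(1,2)[of n] by simp
  obtain s w C where s: "strict_mono (s :: nat \<Rightarrow> nat)" and w: "profile w"
    and rc: "\<And>x. continuous (at_right x) w" and C: "countable C"
    and lim: "\<And>x. x \<notin> C \<Longrightarrow> isCont w x \<and> (\<lambda>n. Z (s n) x) \<longlonglongrightarrow> w x"
    by (rule truncated_limit[of A B Z, OF Z AB]) blast
  have fl: "(\<lambda>n. flux (Z (s n)) x) \<longlonglongrightarrow> flux w x" for x
    by (rule flux_limit[OF truncated_profile[OF Z AB] w C]) (use lim in auto)
  have fpos: "0 \<le> flux w x" for x
    by (rule LIMSEQ_le_const[OF fl]) (use truncated_flux_nonneg[OF Z AB] in auto)
  obtain l r where lr: "(w \<longlongrightarrow> l) at_bot" "(w \<longlongrightarrow> r) at_top" "\<And>x. l \<le> w x" "\<And>x. w x \<le> r"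
    "l \<in> {a..b}" "r \<in> {a..b}" using profile_tendsto[OF w] by metis
  \<comment> \<open>The flux of the limit is nonnegative, its limits at infinity are minus values of \<open>H \<ge> 0\<close>.\<close>
  have "0 \<le> - H l"
    by (rule tendsto_lowerbound[OF flux_tendsto(2)[OF w lr(1)]], use fpos in auto)
  moreover have "0 \<le> - H r"
    by (rule tendsto_lowerbound[OF flux_tendsto(1)[OF w lr(2)]], use fpos in auto)
  ultimately have "l = a \<or> l = b" "r = a \<or> r = b" using H_zero lr by auto
  moreover have "l \<le> m"
  proof -
    obtain t where t: "- 1 < t" "t < 0" "t \<notin> C" using countable_complement_meets[OF C, of "- 1" 0] by auto
    have "w t \<le> m" using lim[OF t(3)] Zm(1)[OF t(2)] by (auto intro: LIMSEQ_le_const2)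
    then show ?thesis using lr(3)[of t] by simp
  qed
  moreover have "m \<le> r"
  proof -
    obtain t where t: "0 < t" "t < 1" "t \<notin> C" using countable_complement_meets[OF C, of 0 1] by auto
    have "m \<le> w t" using lim[OF t(3)] Zm(2)[OF t(1)] by (auto intro: LIMSEQ_le_const)
    then show ?thesis using lr(4)[of t] by simp
  qed
  ultimately have ends: "l = a" "r = b" using m by auto
  have f0: "(flux w \<longlongrightarrow> 0) at_bot" "(flux w \<longlongrightarrow> 0) at_top"
    using flux_tendsto(2)[OF w lr(1)] flux_tendsto(1)[OF w lr(2)] ends H_ends by auto
  have sn: "\<forall>\<^sub>F n in sequentially. c < real (s n)" for c
    using filterlim_compose[OF filterlim_real_sequentially filterlim_subseq[OF s]]
    unfolding filterlim_at_top_dense by auto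
  \<comment> \<open>Since \<open>A n + B n \<ge> 2 n\<close>, one of the two ends is at distance at least \<open>n\<close> infinitely often. Then the
      flux of the limit is monotone on the whole line, decreasing if this is the left end.\<close>
  have zero: "flux w x = 0" for x
  proof (cases "\<exists>\<^sub>F n in sequentially. real (s n) \<le> A (s n)")
    case True
    have "flux w x \<le> flux w y" if "y \<le> x" for y
    proof (rule ccontr)
      assume "\<not> ?thesis"
      then have "0 < flux w x - flux w y" by simp
      then have "\<forall>\<^sub>F n in sequentially. 0 < flux (Z (s n)) x - flux (Z (s n)) y"
        by (rule order_tendstoD(1)[OF tendsto_diff[OF fl fl]])
      from frequently_ex[OF frequently_eventually_conj[OF True eventually_conj[OF this sn[of "- y"]]]]
      obtain n where "real (s n) \<le> A (s n)" "0 < flux (Z (s n)) x - flux (Z (s n)) y" "- y < real (s n)"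
        by auto
      then show False using truncated_flux_nonincreasing[OF Z AB that, of "s n"] by auto
    qed
    then have "\<forall>\<^sub>F y in at_bot. flux w x \<le> flux w y"
      by (rule eventually_mono[OF eventually_le_at_bot[of x]])
    then have "flux w x \<le> 0" using tendsto_lowerbound[OF f0(1)] by auto
    then show ?thesis using fpos[of x] by simp
  next
    case False
    then have ev: "\<forall>\<^sub>F n in sequentially. real (s n) \<le> B (s n)"
      unfolding not_frequently
    proof eventually_elim
      case (elim n) then show ?case using AB0(3)[of "s n"] by simp
    qed
    have "flux w x \<le> flux w y" if "x \<le> y" for y
    proof (rule tendsto_le[OF _ fl fl])
      show "\<forall>\<^sub>F n in sequentially. flux (Z (s n)) x \<le> flux (Z (s n)) y"
        using ev sn[of y] by eventually_elim (use truncated_flux_nondecreasing[OF Z AB that] in auto)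
    qed simp
    then have "\<forall>\<^sub>F y in at_top. flux w x \<le> flux w y"
      by (rule eventually_mono[OF eventually_ge_at_top[of x]])
    then have "flux w x \<le> 0" using tendsto_lowerbound[OF f0(2)] by auto
    then show ?thesis using fpos[of x] by simp
  qed
  \<comment> \<open>A vanishing flux has no sources, which gives the equation at continuity points.\<close>
  have good: "step w x = w x" if "x \<notin> C" for x
  proof -
    have "flux w = (\<lambda>_. 0)" using zero by auto
    then have "(flux w has_real_derivative 0) (at x)" by simp
    from DERIV_unique[OF this flux_deriv[OF w]] show ?thesis using lim[OF that] eps k by auto
  qed
  have "step w x = w x" for x
  proof (rule ccontr)
    assume ne: "step w x \<noteq> w x"
    have "((\<lambda>y. step w y - w y) \<longlongrightarrow> step w x - w x) (at_right x)"
      using continuous_at_imp_continuous_at_within[OF step_cont[OF w, of x], of "{x<..}"] rc[of x]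
      unfolding continuous_within by (intro tendsto_diff)
    then have "\<forall>\<^sub>F y in at_right x. step w y - w y \<noteq> 0"
      by (rule tendsto_imp_eventually_ne) (use ne in simp)
    then obtain d where d: "d > x" "\<And>y. x < y \<Longrightarrow> y < d \<Longrightarrow> step w y - w y \<noteq> 0"
      unfolding eventually_at_right_field by blast
    obtain t where "x < t" "t < d" "t \<notin> C" using countable_complement_meets[OF C d(1)] .
    then show False using d(2)[of t] good[of t] by simp
  qed
  then show ?thesis using that[OF w] lr ends zero by auto
qed

end

section \<open>Regularity of the profile\<close>

text \<open>
The natural choice \<open>V = K' g(w)\<close> would require commuting convolutions. Instead \<open>V\<close> is a
combination of averages for which \<open>V'' = V - g(w)'\<close> holds by \<open>past_mean_cont_deriv\<close> and
\<open>future_mean_cont_deriv\<close> alone: with \<open>P = mean_g w\<close>, so that \<open>P'' = k^2 (P - g(w))\<close>, it is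
\<open>V = (1 - 1/k^2) K' P + P'/k^2\<close>. The first-order equation \<open>\<epsilon> w' = H(w) - V\<close> follows by
differentiating \<open>w = step w\<close> and eliminating the remaining averages by \<open>flux w = 0\<close>.
\<close>

lemma (in viscous_profile) regular_profile_exists:
  assumes g': "\<And>s. (g has_real_derivative g' s) (at s)"
  obtains w V D where "(w \<longlongrightarrow> a) at_bot" "(w \<longlongrightarrow> b) at_top" "(V \<longlongrightarrow> 0) at_bot" "(V \<longlongrightarrow> 0) at_top"
    "\<And>x. (w has_real_derivative (H (w x) - V x) / \<epsilon>) (at x)"
    "\<And>x. (V has_real_derivative D x) (at x)"
    "\<And>x. (D has_real_derivative V x - g' (w x) * ((H (w x) - V x) / \<epsilon>)) (at x)"
proof -
  obtain w where w: "profile w" and ends: "(w \<longlongrightarrow> a) at_bot" "(w \<longlongrightarrow> b) at_top"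
    and fl: "\<And>x. flux w x = 0" and st: "\<And>x. step w x = w x"
    using profile_exists by metis
  have wc: "isCont w x" for x
    using step_cont[OF w, of x] st by (metis ext)
  have gc: "isCont (\<lambda>t. g (w t)) x" and Hc: "isCont (\<lambda>t. H (w t)) x" for x
    using g_cont H_cont by (auto intro!: isCont_o2[OF wc] simp: continuous_on_eq_continuous_at)
  have c1: "isCont (\<lambda>t. - H (w t) - \<epsilon> * k * w t) x" "isCont (\<lambda>t. - H (w t) + \<epsilon> * k * w t) x" for x
    by (intro continuous_intros wc Hc)+
  note bb = profile_bb(4,5)[OF w] mean_g_bounded_borel[OF w] profile_bb(1)[OF w]
  define Kd where "Kd x = (future_mean 1 (mean_g w) x - past_mean 1 (mean_g w) x) / 2" for x
  define Gd where "Gd x = k * (future_mean k (\<lambda>t. g (w t)) x - past_mean k (\<lambda>t. g (w t)) x) / 2" for x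
  define Ks where "Ks x = (past_mean 1 (mean_g w) x + future_mean 1 (mean_g w) x) / 2" for x
  note d = past_mean_cont_deriv(2)[OF k bb(1) c1(1)] future_mean_cont_deriv(2)[OF k bb(2) c1(2)]
    past_mean_cont_deriv(2)[OF zero_less_one bb(3) mean_g_cont[OF w]]
    future_mean_cont_deriv(2)[OF zero_less_one bb(3) mean_g_cont[OF w]]
    past_mean_cont_deriv(2)[OF k bb(4) gc] future_mean_cont_deriv(2)[OF k bb(4) gc]
  have Kd: "(Kd has_real_derivative Ks x - mean_g w x) (at x)" for x
    unfolding Kd_def[abs_def] Ks_def
    by (rule DERIV_cong[OF DERIV_cdivide[OF DERIV_diff[OF d(4) d(3)]]]) (simp add: field_simps)
  have Ks: "(Ks has_real_derivative Kd x) (at x)" for x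
    unfolding Ks_def[abs_def] Kd_def
    by (rule DERIV_cong[OF DERIV_cdivide[OF DERIV_add[OF d(3) d(4)]]]) (simp add: field_simps)
  have G: "(mean_g w has_real_derivative Gd x) (at x)" for x
    unfolding mean_g_def[abs_def] Gd_def
    by (rule DERIV_cong[OF DERIV_cdivide[OF DERIV_add[OF d(5) d(6)]]]) (simp add: field_simps)
  have Gd: "(Gd has_real_derivative k\<^sup>2 * (mean_g w x - g (w x))) (at x)" for x
    unfolding Gd_def[abs_def] mean_g_def
    by (rule DERIV_cong[OF DERIV_cdivide[OF DERIV_cmult[OF DERIV_diff[OF d(6) d(5)]]]])
       (simp add: field_simps power2_eq_square)
  define V where "V x = (1 - 1 / k\<^sup>2) * Kd x + Gd x / k\<^sup>2" for x
  define D where "D x = (1 - 1 / k\<^sup>2) * (Ks x - mean_g w x) + (mean_g w x - g (w x))" for x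
  have V': "(V has_real_derivative D x) (at x)" for x
    unfolding V_def[abs_def] D_def
    by (rule DERIV_cong[OF DERIV_add[OF DERIV_cmult[OF Kd] DERIV_cdivide[OF Gd]]]) (use k in simp)
  have w': "(w has_real_derivative (H (w x) - V x) / \<epsilon>) (at x)" for x
  proof -
    let ?p = "past_mean k (\<lambda>t. - H (w t) - \<epsilon> * k * w t)"
    let ?q = "future_mean k (\<lambda>t. - H (w t) + \<epsilon> * k * w t)"
    have "w y = (k * (?q y - ?p y) / 2 + Ks y - mean_g w y) / (\<epsilon> * k\<^sup>2)" for y
      using step_alt[OF w, of y] eps k unfolding st Ks_def by (simp add: field_simps)
    then have weq: "w = (\<lambda>y. (k * (?q y - ?p y) / 2 + Ks y - mean_g w y) / (\<epsilon> * k\<^sup>2))" by (rule ext)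
    have halves: "A = - 2 * (B / 2)" if "A / 2 + B / 2 = 0" for A B :: real
      using that by linarith
    have pq: "?p x + ?q x = - 2 * Kd x" using fl[of x] unfolding flux_def Kd_def by (rule halves)
    have "((\<lambda>y. (k * (?q y - ?p y) / 2 + Ks y - mean_g w y) / (\<epsilon> * k\<^sup>2)) has_real_derivative
       (k * (k * (?q x - (- H (w x) + \<epsilon> * k * w x)) - k * ((- H (w x) - \<epsilon> * k * w x) - ?p x)) / 2 + Kd x - Gd x) / (\<epsilon> * k\<^sup>2)) (at x)"
      by (intro DERIV_cdivide DERIV_diff DERIV_add DERIV_cmult d Ks G)
    moreover have "(k * (k * (?q x - (- H (w x) + \<epsilon> * k * w x)) - k * ((- H (w x) - \<epsilon> * k * w x) - ?p x)) / 2 + Kd x - Gd x) / (\<epsilon> * k\<^sup>2)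
      = (k\<^sup>2 * ((?p x + ?q x) / 2 + H (w x)) + Kd x - Gd x) / (\<epsilon> * k\<^sup>2)"
      by (simp add: algebra_simps power2_eq_square add_divide_distrib diff_divide_distrib)
    moreover have "\<dots> = (H (w x) - V x) / \<epsilon>"
      unfolding pq V_def using eps k by (simp add: field_simps)
    ultimately show ?thesis using weq by metis
  qed
  have D': "(D has_real_derivative V x - g' (w x) * ((H (w x) - V x) / \<epsilon>)) (at x)" for x
    unfolding D_def[abs_def]
    by (rule DERIV_cong[OF DERIV_add[OF DERIV_cmult[OF DERIV_diff[OF Ks G]] DERIV_diff[OF G DERIV_chain2[OF g' w']]]])
       (simp add: V_def algebra_simps diff_divide_distrib)
  have gt: "((\<lambda>t. g (w t)) \<longlongrightarrow> g r) F" if "(w \<longlongrightarrow> r) F" for r F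
    using continuous_on_tendsto_compose[OF g_cont that] by auto
  have "(V \<longlongrightarrow> (1 - 1 / k\<^sup>2) * ((g a - g a) / 2) + (k * (g a - g a) / 2) / k\<^sup>2) at_bot"
    unfolding V_def[abs_def] Kd_def Gd_def
    by (intro tendsto_intros past_mean_tendsto(2) future_mean_tendsto(2) k bb mean_g_tendsto(2) w gt ends) (use k in auto)
  moreover have "(V \<longlongrightarrow> (1 - 1 / k\<^sup>2) * ((g b - g b) / 2) + (k * (g b - g b) / 2) / k\<^sup>2) at_top"
    unfolding V_def[abs_def] Kd_def Gd_def
    by (intro tendsto_intros past_mean_tendsto(1) future_mean_tendsto(1) k bb mean_g_tendsto(1) w gt ends) (use k in auto)
  ultimately show ?thesis using that[OF ends _ _ w' V' D'] by simp
qed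

section \<open>From profiles to propagating fronts\<close>

text \<open>
If \<open>M\<close> bounds \<open>\<bar>g'\<bar>\<close> and \<open>\<bar>H'\<bar>\<close> on \<open>[a, b]\<close>, then \<open>k = 1 + 2 M / \<epsilon>\<close> makes both \<open>g' / (\<epsilon> k^2)\<close> and
\<open>H' / (\<epsilon> k)\<close> at most one half.
\<close>

lemma relaxation_rate_exists:
  fixes g' H' :: "real \<Rightarrow> real"
  assumes eps: "\<epsilon> > 0" and g: "\<And>s. (g has_real_derivative g' s) (at s)" and H: "\<And>s. (H has_real_derivative H' s) (at s)"
    and c: "continuous_on {a..b} g'" "continuous_on {a..b} H'"
  obtains k where "k > 0"
    "mono_on {a..b} (\<lambda>s. s - g s / (\<epsilon> * k\<^sup>2) + H s / (\<epsilon> * k))"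
    "mono_on {a..b} (\<lambda>s. s - g s / (\<epsilon> * k\<^sup>2) - H s / (\<epsilon> * k))"
proof -
  have "bounded (g' ` {a..b} \<union> H' ` {a..b})"
    using c by (intro bounded_Un[THEN iffD2] conjI compact_imp_bounded compact_continuous_image) auto
  then obtain M0 where M0: "\<forall>y\<in>g' ` {a..b} \<union> H' ` {a..b}. norm y \<le> M0" unfolding bounded_iff by blast
  define M where "M = max M0 0"
  have M: "0 \<le> M" "\<And>s. s \<in> {a..b} \<Longrightarrow> \<bar>g' s\<bar> \<le> M" "\<And>s. s \<in> {a..b} \<Longrightarrow> \<bar>H' s\<bar> \<le> M"
    using M0 unfolding M_def by (auto simp: le_max_iff_disj)
  define k where "k = 1 + 2 * M / \<epsilon>"
  have k: "k \<ge> 1" unfolding k_def using M eps by simp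
  have "\<epsilon> * k = \<epsilon> + 2 * M" unfolding k_def using eps by (simp add: field_simps)
  then have ek: "2 * M \<le> \<epsilon> * k" "0 < \<epsilon> * k" using eps M(1) by linarith+
  have "\<epsilon> * k * 1 \<le> \<epsilon> * k\<^sup>2" unfolding power2_eq_square mult.assoc[symmetric] using k ek by (intro mult_left_mono) auto
  then have ek2: "2 * M \<le> \<epsilon> * k\<^sup>2" "0 < \<epsilon> * k\<^sup>2" using ek by linarith+
  have half: "\<bar>y / r\<bar> \<le> 1 / 2" if "\<bar>y\<bar> \<le> M" "2 * M \<le> r" "0 < r" for y r
    using that by (simp add: field_simps)
  have 1: "mono_on {a..b} (\<lambda>s. s - g s / (\<epsilon> * k\<^sup>2) + \<sigma> * H s / (\<epsilon> * k))" if \<sigma>: "\<bar>\<sigma>\<bar> \<le> 1" for \<sigma>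
  proof (rule mono_onI)
    fix r s assume rs: "r \<in> {a..b}" "s \<in> {a..b}" "r \<le> s"
    show "r - g r / (\<epsilon> * k\<^sup>2) + \<sigma> * H r / (\<epsilon> * k) \<le> s - g s / (\<epsilon> * k\<^sup>2) + \<sigma> * H s / (\<epsilon> * k)"
    proof (rule DERIV_nonneg_imp_nondecreasing[OF rs(3)])
      fix t assume "r \<le> t" "t \<le> s"
      then have t: "t \<in> {a..b}" using rs by auto
      have d: "((\<lambda>s. s - g s / (\<epsilon> * k\<^sup>2) + \<sigma> * H s / (\<epsilon> * k)) has_real_derivative
          1 - g' t / (\<epsilon> * k\<^sup>2) + \<sigma> * H' t / (\<epsilon> * k)) (at t)"
        by (intro DERIV_add DERIV_diff DERIV_ident DERIV_cdivide DERIV_cmult g H)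
      have "\<bar>\<sigma> * H' t\<bar> \<le> 1 * M" unfolding abs_mult by (intro mult_mono \<sigma> M t) auto
      then have "- (\<sigma> * H' t / (\<epsilon> * k)) \<le> 1 / 2"
        by (intro abs_le_D2[OF half[OF _ ek]]) simp
      moreover have "g' t / (\<epsilon> * k\<^sup>2) \<le> 1 / 2"
        by (rule abs_le_D1[OF half[OF M(2)[OF t] ek2]])
      ultimately have "0 \<le> 1 - g' t / (\<epsilon> * k\<^sup>2) + \<sigma> * H' t / (\<epsilon> * k)" by linarith
      then show "\<exists>y. ((\<lambda>s. s - g s / (\<epsilon> * k\<^sup>2) + \<sigma> * H s / (\<epsilon> * k)) has_real_derivative y) (at t) \<and> 0 \<le> y"
        using d by blast
    qed
  qed
  show ?thesis using that[of k] k 1[of 1] 1[of "- 1"] by simp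
qed

lemma has_deriv_of_C1:
  fixes h :: "real \<Rightarrow> real"
  assumes "h C1_differentiable_on UNIV"
  shows "(h has_real_derivative deriv h x) (at x)" "continuous_on UNIV (deriv h)"
proof -
  obtain D where D: "\<And>x. (h has_real_derivative D x) (at x)" "continuous_on UNIV D"
    using assms unfolding C1_differentiable_on_def has_real_derivative_iff_has_vector_derivative by auto
  then have "deriv h = D" using DERIV_imp_deriv by blast
  then show "(h has_real_derivative deriv h x) (at x)" "continuous_on UNIV (deriv h)" using D by auto
qed

lemma chord_above_convex:
  fixes f f' :: "real \<Rightarrow> real"
  assumes f: "\<And>s. (f has_real_derivative f' s) (at s)" and mono: "strict_mono f'"
    and c: "f b - f a = c * (b - a)" and s: "a < s" "s < b"
  shows "f s < f b + c * (s - b)"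
proof (rule ccontr)
  assume neg: "\<not> ?thesis"
  obtain p where p: "p < s" "f s - f a = (s - a) * f' p" using MVT2[OF s(1) f] by auto
  obtain q where q: "s < q" "f b - f s = (b - s) * f' q" using MVT2[OF s(2) f] by auto
  have "(b - s) * f' q = f b - f s" using q(2) by simp
  also have "\<dots> \<le> (b - s) * c" using neg by (simp add: algebra_simps)
  finally have "f' q \<le> c" using s by simp
  have "(s - a) * c = f b - f a - c * (b - s)" using c by (simp add: algebra_simps)
  also have "\<dots> \<le> f s - f a" using neg by (simp add: algebra_simps)
  also have "\<dots> = (s - a) * f' p" using p(2) .
  finally have "c \<le> f' p" using s by simp
  then show False using \<open>f' q \<le> c\<close> strict_monoD[OF mono, of p q] p q by simp
qed

lemma travelling_wave_jointly_continuous: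
  assumes "continuous_on UNIV F" shows "jointly_continuous (\<lambda>t x. F (x - c * t))"
  unfolding jointly_continuous_def case_prod_unfold
  by (rule continuous_on_compose2[OF assms]) (auto intro!: continuous_intros)

lemma travelling_wave_derivs:
  assumes F: "\<And>y. (F has_real_derivative F1 y) (at y)"
  shows "((\<lambda>y. F (y - c * t)) has_real_derivative F1 (x - c * t)) (at x)"
    and "((\<lambda>s. F (x - c * s)) has_real_derivative - c * F1 (x - c * t)) (at t)"
    and "dx (\<lambda>t x. F (x - c * t)) = (\<lambda>t x. F1 (x - c * t))"
    and "dt (\<lambda>t x. F (x - c * t)) = (\<lambda>t x. - c * F1 (x - c * t))"
proof -
  show 1: "((\<lambda>y. F (y - c * t)) has_real_derivative F1 (x - c * t)) (at x)" for t x
    by (rule DERIV_cong[OF DERIV_chain2[OF F DERIV_diff[OF DERIV_ident DERIV_const]]]) simp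
  show 2: "((\<lambda>s. F (x - c * s)) has_real_derivative - c * F1 (x - c * t)) (at t)" for t x
    by (rule DERIV_cong[OF DERIV_chain2[OF F DERIV_diff[OF DERIV_const DERIV_cmult[OF DERIV_ident]]]]) simp
  show "dx (\<lambda>t x. F (x - c * t)) = (\<lambda>t x. F1 (x - c * t))"
    unfolding dx_def[abs_def] using DERIV_imp_deriv[OF 1] by auto
  show "dt (\<lambda>t x. F (x - c * t)) = (\<lambda>t x. - c * F1 (x - c * t))"
    unfolding dt_def[abs_def] using DERIV_imp_deriv[OF 2] by auto
qed

lemma travelling_wave_C2_in_space:
  assumes F: "\<And>y. (F has_real_derivative F1 y) (at y)" "\<And>y. (F1 has_real_derivative F2 y) (at y)"
    and F2: "continuous_on UNIV F2"
  shows "C2_in_space (\<lambda>t x. F (x - c * t))"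
proof -
  note d = travelling_wave_derivs[of F F1, OF F(1)] travelling_wave_derivs[of F1 F2, OF F(2)]
  have c: "continuous_on UNIV F" "continuous_on UNIV F1"
    using F by (auto intro!: DERIV_continuous_on)
  have "(\<lambda>y. F (y - c * t)) differentiable (at x)" "(\<lambda>y. F1 (y - c * t)) differentiable (at x)" for t x
    using d(1,5) real_differentiable_def by blast+
  then show ?thesis
    unfolding C2_in_space_def d(3) d(7)
    using travelling_wave_jointly_continuous[OF c(1)] travelling_wave_jointly_continuous[OF c(2)]
      travelling_wave_jointly_continuous[OF F2] by blast
qed

lemma travelling_wave_classical_solution:
  assumes U: "\<And>y. (U has_real_derivative U1 y) (at y)" "\<And>y. (U1 has_real_derivative U2 y) (at y)" "continuous_on UNIV U2"
    and V: "\<And>y. (V has_real_derivative V1 y) (at y)" "\<And>y. (V1 has_real_derivative V2 y) (at y)" "continuous_on UNIV V2"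
    and fg: "\<And>s. (f has_real_derivative f' s) (at s)" "\<And>s. (g has_real_derivative g' s) (at s)"
    and eq: "\<And>y. - c * U1 y + f' (U y) * U1 y - \<epsilon> * U2 y = V1 y" "\<And>y. V y - V2 y = g' (U y) * U1 y"
  shows "classical_solution \<epsilon> f g (\<lambda>t x. U (x - c * t)) (\<lambda>t x. V (x - c * t))"
proof -
  note dU = travelling_wave_derivs[of U U1, OF U(1)] and dU1 = travelling_wave_derivs[of U1 U2, OF U(2)]
    and dV = travelling_wave_derivs[of V V1, OF V(1)] and dV1 = travelling_wave_derivs[of V1 V2, OF V(2)]
  have f: "dx (\<lambda>t x. f (U (x - c * t))) = (\<lambda>t x. f' (U (x - c * t)) * U1 (x - c * t))"
    by (rule travelling_wave_derivs(3)[of "\<lambda>y. f (U y)" "\<lambda>y. f' (U y) * U1 y"]) (rule DERIV_chain2[OF fg(1) U(1)])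
  have g: "dx (\<lambda>t x. g (U (x - c * t))) = (\<lambda>t x. g' (U (x - c * t)) * U1 (x - c * t))"
    by (rule travelling_wave_derivs(3)[of "\<lambda>y. g (U y)" "\<lambda>y. g' (U y) * U1 y"]) (rule DERIV_chain2[OF fg(2) U(1)])
  have "continuous_on UNIV U1" using U(2) by (auto intro!: DERIV_continuous_on)
  then have "continuous_on UNIV (\<lambda>y. - c * U1 y)" by (intro continuous_intros)
  then have "jointly_continuous (\<lambda>t x. - c * U1 (x - c * t))"
    by (rule travelling_wave_jointly_continuous)
  moreover have "(\<lambda>s. U (x - c * s)) differentiable (at t)" for t x
    unfolding real_differentiable_def by (rule exI, rule dU(2))
  ultimately have "C1_in_time (\<lambda>t x. U (x - c * t))"
    unfolding C1_in_time_def dU(4) by blast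
  then show ?thesis
    unfolding classical_solution_def f g dU(3,4) dU1(3) dV(3) dV1(3)
    using travelling_wave_C2_in_space[OF U] travelling_wave_C2_in_space[OF V] eq by auto
qed

text \<open>
Reflection \<open>U y = w (- y)\<close> requires the sign change \<open>V y \<mapsto> - V (- y)\<close>, because \<open>V\<close> balances first
derivatives. The equations for \<open>w\<close> and \<open>V\<close> then turn into the two equations of the system.
\<close>

lemma decreasing_front_exists:
  fixes f g f' g' :: "real \<Rightarrow> real"
  assumes f: "\<And>s. (f has_real_derivative f' s) (at s)" "continuous_on UNIV f'" "strict_mono f'"
    and g: "\<And>s. (g has_real_derivative g' s) (at s)" "continuous_on UNIV g'" "\<And>s. 0 \<le> g' s"
    and eps: "\<epsilon> > 0" and ab: "a < b" and c: "f b - f a = c * (b - a)"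
  shows "\<exists>U V. propagating_front \<epsilon> f g b a U V c"
proof -
  define H where "H s = f b + c * (s - b) - f s" for s
  define H' where "H' s = c - f' s" for s
  have H': "(H has_real_derivative H' s) (at s)" for s
    unfolding H_def[abs_def] H'_def by (auto intro!: derivative_eq_intros f)
  have H'c: "continuous_on UNIV H'" unfolding H'_def[abs_def] by (intro continuous_intros f)
  obtain k where k: "k > 0"
    "mono_on {a..b} (\<lambda>s. s - g s / (\<epsilon> * k\<^sup>2) + H s / (\<epsilon> * k))"
    "mono_on {a..b} (\<lambda>s. s - g s / (\<epsilon> * k\<^sup>2) - H s / (\<epsilon> * k))"
    using relaxation_rate_exists[OF eps g(1) H', of a b] g(2) H'c continuous_on_subset by blast
  interpret viscous_profile a b \<epsilon> k g H
  proof
    show "continuous_on UNIV g" "continuous_on UNIV H"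
      using g H' by (auto intro!: DERIV_continuous_on)
    show "mono_on {a..b} g"
    proof (rule mono_onI)
      show "g r \<le> g s" if "r \<le> s" for r s
        by (rule DERIV_nonneg_imp_nondecreasing[OF that]) (use g in blast)
    qed
    show "H a = 0" "H b = 0" using c unfolding H_def by (auto simp: algebra_simps)
    show "0 < H s" if "a < s" "s < b" for s
      using chord_above_convex[OF f(1,3) c that] unfolding H_def by simp
  qed (fact ab eps k)+
  obtain w V D where ends: "(w \<longlongrightarrow> a) at_bot" "(w \<longlongrightarrow> b) at_top" "(V \<longlongrightarrow> 0) at_bot" "(V \<longlongrightarrow> 0) at_top"
    and w': "\<And>x. (w has_real_derivative (H (w x) - V x) / \<epsilon>) (at x)"
    and V': "\<And>x. (V has_real_derivative D x) (at x)"
    and D': "\<And>x. (D has_real_derivative V x - g' (w x) * ((H (w x) - V x) / \<epsilon>)) (at x)"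
    by (rule regular_profile_exists[OF g(1)]) blast
  have mirror: "((\<lambda>y. F (- y)) has_real_derivative - F1 (- y)) (at y)"
    if "\<And>x. (F has_real_derivative F1 x) (at x)" for F F1 :: "real \<Rightarrow> real" and y
    by (rule DERIV_cong[OF DERIV_chain2[OF that DERIV_minus[OF DERIV_ident]]]) simp
  define W1 where "W1 x = (H (w x) - V x) / \<epsilon>" for x
  define W2 where "W2 x = (H' (w x) * W1 x - D x) / \<epsilon>" for x
  define D1 where "D1 x = V x - g' (w x) * W1 x" for x
  have W1: "(w has_real_derivative W1 x) (at x)" for x using w' unfolding W1_def .
  have W2: "(W1 has_real_derivative W2 x) (at x)" for x
  proof -
    have "((\<lambda>x. (H (w x) - V x) / \<epsilon>) has_real_derivative W2 x) (at x)"
      unfolding W2_def by (intro DERIV_cdivide DERIV_diff V' DERIV_chain2[OF H' W1])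
    then show ?thesis by (simp only: W1_def[abs_def])
  qed
  have D1: "(D has_real_derivative D1 x) (at x)" for x using D' unfolding D1_def W1_def .
  have cont: "continuous_on UNIV F" if "\<And>x. (F has_real_derivative F1 x) (at x)" for F F1 :: "real \<Rightarrow> real"
    using that by (auto intro!: DERIV_continuous_on)
  have cH: "continuous_on UNIV (\<lambda>x. H' (w x))" "continuous_on UNIV (\<lambda>x. g' (w x))"
    by (rule continuous_on_compose2[OF H'c cont[OF W1]] continuous_on_compose2[OF g(2) cont[OF W1]]; simp)+
  have cont2: "continuous_on UNIV W2" "continuous_on UNIV D1"
    unfolding W2_def[abs_def] D1_def[abs_def] using eps
    by (intro continuous_intros cH cont[OF W1] cont[OF W2] cont[OF V'] cont[OF D1]; simp)+
  have cr: "continuous_on UNIV (\<lambda>y. F (- y))" if "continuous_on UNIV F" for F :: "real \<Rightarrow> real"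
    by (rule continuous_on_compose2[OF that]) (auto intro!: continuous_intros)
  have "classical_solution \<epsilon> f g (\<lambda>t x. w (- (x - c * t))) (\<lambda>t x. - V (- (x - c * t)))"
  proof (rule travelling_wave_classical_solution)
    show "((\<lambda>y. w (- y)) has_real_derivative - W1 (- y)) (at y)" for y by (rule mirror[OF W1])
    show "((\<lambda>y. - W1 (- y)) has_real_derivative W2 (- y)) (at y)" for y
      using DERIV_minus[OF mirror[OF W2]] by simp
    show "continuous_on UNIV (\<lambda>y. W2 (- y))" by (rule cr[OF cont2(1)])
    show "((\<lambda>y. - V (- y)) has_real_derivative D (- y)) (at y)" for y
      using DERIV_minus[OF mirror[OF V']] by simp
    show "((\<lambda>y. D (- y)) has_real_derivative - D1 (- y)) (at y)" for y by (rule mirror[OF D1])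
    show "continuous_on UNIV (\<lambda>y. - D1 (- y))" by (intro continuous_intros cr[OF cont2(2)])
    show "- c * - W1 (- y) + f' (w (- y)) * - W1 (- y) - \<epsilon> * W2 (- y) = D (- y)" for y
    proof -
      have "\<epsilon> * W2 (- y) = H' (w (- y)) * W1 (- y) - D (- y)" unfolding W2_def using eps by simp
      then show ?thesis unfolding H'_def by (simp add: algebra_simps)
    qed
    show "- V (- y) - - D1 (- y) = g' (w (- y)) * - W1 (- y)" for y
      unfolding D1_def by (simp add: algebra_simps)
  qed (fact f g)+
  moreover have "((\<lambda>y. w (- y)) \<longlongrightarrow> b) at_bot" "((\<lambda>y. - V (- y)) \<longlongrightarrow> 0) at_bot"
    "((\<lambda>y. w (- y)) \<longlongrightarrow> a) at_top" "((\<lambda>y. - V (- y)) \<longlongrightarrow> 0) at_top"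
    using ends tendsto_minus[OF ends(3)] tendsto_minus[OF ends(4)]
    by (simp_all add: filterlim_at_bot_mirror)
  ultimately show ?thesis
    unfolding propagating_front_def by (intro exI[of _ "\<lambda>y. w (- y)"] exI[of _ "\<lambda>y. - V (- y)"]) simp
qed

theorem theorem1p3:
  fixes f g :: "real \<Rightarrow> real" and \<epsilon> u_plus :: real
  assumes "C2_real f" and "g C1_differentiable_on UNIV"
    and "\<And>u. deriv (deriv f) u > 0" and "\<And>u. deriv g u > 0"
    and "\<epsilon> > 0"
  shows "\<exists>\<delta>\<^sub>0>0. \<forall>u_minus c.
           0 < \<bar>u_plus - u_minus\<bar> \<and> \<bar>u_plus - u_minus\<bar> < \<delta>\<^sub>0 \<and>
           c = (f u_plus - f u_minus) / (u_plus - u_minus) \<and>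
           deriv f u_plus < c \<and> c < deriv f u_minus \<longrightarrow>
           (\<exists>U V. propagating_front \<epsilon> f g u_minus u_plus U V c)"
proof (intro exI[of _ 1] conjI allI impI)
  fix u_minus c
  assume *: "0 < \<bar>u_plus - u_minus\<bar> \<and> \<bar>u_plus - u_minus\<bar> < 1 \<and>
           c = (f u_plus - f u_minus) / (u_plus - u_minus) \<and>
           deriv f u_plus < c \<and> c < deriv f u_minus"
  have f: "f C1_differentiable_on UNIV" "deriv f C1_differentiable_on UNIV"
    using assms(1) unfolding C2_real_def by auto
  have mono: "strict_mono (deriv f)"
  proof (rule strict_monoI)
    show "deriv f r < deriv f s" if "r < s" for r s
      by (rule DERIV_pos_imp_increasing[OF that]) (use has_deriv_of_C1(1)[OF f(2)] assms(3) in blast)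
  qed
  then have "u_plus < u_minus" using * by (meson order_less_trans strict_mono_less)
  moreover have "f u_minus - f u_plus = c * (u_minus - u_plus)"
    using * by (simp add: field_simps)
  ultimately show "\<exists>U V. propagating_front \<epsilon> f g u_minus u_plus U V c"
    using has_deriv_of_C1[OF f(1)] has_deriv_of_C1[OF assms(2)] mono assms(4,5)
    by (intro decreasing_front_exists[of f "deriv f" g "deriv g"]) (auto intro: less_imp_le)
qed simp

end
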